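(* Let $\lambda\in\mathbf R$ (notation of the context). There exists a family of real touching conics of orbit type in $H_\lambda$, parametrized by the non-zero real numbers, with defining equations $$y_2y_3=\alpha y_1^2,\qquad\alpha\in\mathbf R^\times,$$ and every real touching conic of orbit type in $H_\lambda$ is contained in this family.
   Context: Fix real numbers $a,b>0$ and a real quadratic form $Q(y_0,y_1)$; put $f(\lambda)=\lambda(\lambda+1)(a\lambda-b)$. Assume: there is $\lambda_0\in\mathbf R$ such that $Q(\lambda,1)^2-f(\lambda)\ge0$ for all $\lambda\in\mathbf R$ with equality iff $\lambda=\lambda_0$, and $\lambda_0$ is a root of multiplicity two; and $Q(\lambda,1)>\sqrt{f(\lambda)}$ whenever $\lambda\in\mathbf R$, $f(\lambda)\ge0$, $\lambda\ne\lambda_0$. $B\subset\mathbf{CP}^3$ is the quartic surface $(y_2y_3+Q(y_0,y_1))^2-y_0y_1(y_0+y_1)(ay_0-by_1)=0$; the real structure on $\mathbf{CP}^3$ is $\sigma(y_0:y_1:y_2:y_3)=(\overline y_0:\overline y_1:\overline y_3:\overline y_2)$. For $\lambda\in\mathbf R$, $H_\lambda=\{y_0=\lambda y_1\}$ is a real plane with homogeneous coordinates $(y_1:y_2:y_3)$, and $B_\lambda=B\cap H_\lambda$ is the quartic curve $(y_2y_3+Q(\lambda,1)y_1^2)^2-f(\lambda)y_1^4=0$. Put $P_\infty=(0:0:0:1)$, $\overline P_\infty=(0:0:1:0)$. "Real" means invariant under $\sigma$. A real touching conic in $H_\lambda$ is a real irreducible conic $C\subset H_\lambda$ such that either $C\subset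 B$ or the local intersection number of $C$ with $B_\lambda$ is at least two at every intersection point. It is of orbit type if $(C,B_\lambda)_{P_\infty}=(C,B_\lambda)_{\overline P_\infty}=4$ (local intersection numbers); real irreducible conics contained in $B_\lambda$ are also regarded as being of orbit type. *)

theory Defs
  imports
    Complex_Main
    "HOL-Library.Extended_Nat"
    "HOL-Computational_Algebra.Computational_Algebra"
begin

section \<open>Complex projective 3-space and its real structure\<close>

type_synonym cvec4 = "complex \<times> complex \<times> complex \<times> complex"

definition proportional :: "cvec4 \<Rightarrow> cvec4 \<Rightarrow> bool" where
  "proportional = (\<lambda>(x0, x1, x2, x3) (y0, y1, y2, y3).
     (x0, x1, x2, x3) \<noteq> (0, 0, 0, 0) \<and> (y0, y1, y2, y3) \<noteq> (0, 0, 0, 0) \<and>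
     (\<exists>c. x0 = c * y0 \<and> x1 = c * y1 \<and> x2 = c * y2 \<and> x3 = c * y3))"

lemma proportionalE:
  assumes "proportional x y"
  obtains x0 x1 x2 x3 y0 y1 y2 y3 c where
    "x = (x0, x1, x2, x3)" "y = (y0, y1, y2, y3)" "x \<noteq> (0, 0, 0, 0)" "y \<noteq> (0, 0, 0, 0)"
    "x0 = c * y0" "x1 = c * y1" "x2 = c * y2" "x3 = c * y3"
proof -
  obtain x0 x1 x2 x3 where x: "x = (x0, x1, x2, x3)" by (cases x) auto
  obtain y0 y1 y2 y3 where y: "y = (y0, y1, y2, y3)" by (cases y) auto
  show thesis
    using assms that[of x0 x1 x2 x3 y0 y1 y2 y3] unfolding x y proportional_def prod.case by blast
qed

lemma part_equivp_proportional: "part_equivp proportional"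
proof (rule part_equivpI)
  show "\<exists>x. proportional x x"
    by (rule exI[of _ "(1, 0, 0, 0)"]) (auto simp: proportional_def)
  show "symp proportional"
  proof (rule sympI)
    fix x y assume "proportional x y"
    then obtain x0 x1 x2 x3 y0 y1 y2 y3 c where
      xy: "x = (x0, x1, x2, x3)" "y = (y0, y1, y2, y3)"
      and nz: "x \<noteq> (0, 0, 0, 0)" "y \<noteq> (0, 0, 0, 0)"
      and c: "x0 = c * y0" "x1 = c * y1" "x2 = c * y2" "x3 = c * y3"
      by (elim proportionalE) blast
    have "c \<noteq> 0" using nz c xy by auto
    then have "y0 = inverse c * x0 \<and> y1 = inverse c * x1 \<and> y2 = inverse c * x2 \<and> y3 = inverse c * x3"
      using c by simp
    then show "proportional y x"
      using nz unfolding xy proportional_def by blast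
  qed
  show "transp proportional"
  proof (rule transpI)
    fix x y z assume "proportional x y" "proportional y z"
    from \<open>proportional x y\<close> obtain x0 x1 x2 x3 y0 y1 y2 y3 c where
      xy: "x = (x0, x1, x2, x3)" "y = (y0, y1, y2, y3)" and nzx: "x \<noteq> (0, 0, 0, 0)"
      and c: "x0 = c * y0" "x1 = c * y1" "x2 = c * y2" "x3 = c * y3"
      by (elim proportionalE) blast
    from \<open>proportional y z\<close> obtain z0 z1 z2 z3 d where
      z: "z = (z0, z1, z2, z3)" and nzz: "z \<noteq> (0, 0, 0, 0)"
      and d: "y0 = d * z0" "y1 = d * z1" "y2 = d * z2" "y3 = d * z3"
      unfolding xy by (elim proportionalE) blast
    note xyz = xy z and nz = nzx nzz
    have "x0 = (c * d) * z0 \<and> x1 = (c * d) * z1 \<and> x2 = (c * d) * z2 \<and> x3 = (c * d) * z3"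
      using c d by simp
    then show "proportional x z"
      using nz unfolding xyz proportional_def by blast
  qed
qed

quotient_type cp3 = cvec4 / partial: proportional
  by (rule part_equivp_proportional)

text \<open>\<open>pt y0 y1 y2 y3\<close> is the point \<open>(y0 : y1 : y2 : y3)\<close>; it is meaningful only if the
  coordinates are not all zero.\<close>

definition pt :: "complex \<Rightarrow> complex \<Rightarrow> complex \<Rightarrow> complex \<Rightarrow> cp3" where
  "pt y0 y1 y2 y3 = abs_cp3 (y0, y1, y2, y3)"

lemma pt_eq_iff:
  assumes "(x0, x1, x2, x3) \<noteq> (0, 0, 0, 0)" "(y0, y1, y2, y3) \<noteq> (0, 0, 0, 0)"
  shows "pt x0 x1 x2 x3 = pt y0 y1 y2 y3 \<longleftrightarrow> proportional (x0, x1, x2, x3) (y0, y1, y2, y3)"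
proof -
  have "proportional (x0, x1, x2, x3) (x0, x1, x2, x3)"
    "proportional (y0, y1, y2, y3) (y0, y1, y2, y3)"
    using assms by (auto simp: proportional_def intro: exI[of _ 1])
  then show ?thesis
    using Quotient3_rel[OF Quotient3_cp3] unfolding pt_def by blast
qed

lift_definition real_structure :: "cp3 \<Rightarrow> cp3"
  is "\<lambda>(y0, y1, y2, y3). (cnj y0, cnj y1, cnj y3, cnj y2)"
proof -
  fix x y assume "proportional x y"
  then obtain x0 x1 x2 x3 y0 y1 y2 y3 c where
    xy: "x = (x0, x1, x2, x3)" "y = (y0, y1, y2, y3)"
    and nz: "x \<noteq> (0, 0, 0, 0)" "y \<noteq> (0, 0, 0, 0)"
    and c: "x0 = c * y0" "x1 = c * y1" "x2 = c * y2" "x3 = c * y3"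
    by (elim proportionalE) blast
  have "cnj x0 = cnj c * cnj y0 \<and> cnj x1 = cnj c * cnj y1 \<and>
        cnj x3 = cnj c * cnj y3 \<and> cnj x2 = cnj c * cnj y2"
    using c by simp
  moreover have "(cnj x0, cnj x1, cnj x3, cnj x2) \<noteq> (0, 0, 0, 0)"
    "(cnj y0, cnj y1, cnj y3, cnj y2) \<noteq> (0, 0, 0, 0)"
    using nz xy by auto
  ultimately show "proportional ((\<lambda>(y0, y1, y2, y3). (cnj y0, cnj y1, cnj y3, cnj y2)) x)
                     ((\<lambda>(y0, y1, y2, y3). (cnj y0, cnj y1, cnj y3, cnj y2)) y)"
    unfolding xy proportional_def prod.case by blast
qed

definition real_subset :: "cp3 set \<Rightarrow> bool" where
  "real_subset C \<longleftrightarrow> real_structure ` C = C"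


section \<open>Ternary polynomials\<close>

text \<open>The ring \<open>\<complex>[y1, y2, y3]\<close> is represented as \<open>\<complex>[y1][y2][y3]\<close>: the innermost variable is \<open>y1\<close>,
  the outermost one is \<open>y3\<close>.\<close>

type_synonym tpoly = "complex poly poly poly"

definition const3 :: "complex \<Rightarrow> tpoly" where "const3 c = [:[:[:c:]:]:]"
definition Y1 :: tpoly where "Y1 = [:[:[:0, 1:]:]:]"
definition Y2 :: tpoly where "Y2 = [:[:0, 1:]:]"
definition Y3 :: tpoly where "Y3 = [:0, 1:]"

definition eval3 :: "tpoly \<Rightarrow> complex \<Rightarrow> complex \<Rightarrow> complex \<Rightarrow> complex" where
  "eval3 F y1 y2 y3 = poly (poly (poly F [:[:y3:]:]) [:y2:]) y1"

definition homogeneous :: "nat \<Rightarrow> tpoly \<Rightarrow> bool" where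
  "homogeneous d F \<longleftrightarrow>
     (\<forall>i j k. coeff (coeff (coeff F k) j) i \<noteq> 0 \<longrightarrow> i + j + k = d)"


section \<open>Local intersection numbers of plane curves\<close>

text \<open>The local ring of the projective plane at \<open>P = (p1 : p2 : p3)\<close>, inside the field
  \<open>\<complex>(y1, y2, y3)\<close>.\<close>

definition local_ring :: "complex \<Rightarrow> complex \<Rightarrow> complex \<Rightarrow> tpoly fract set" where
  "local_ring p1 p2 p3 =
     {Fract A S | A S d. homogeneous d A \<and> homogeneous d S \<and> eval3 S p1 p2 p3 \<noteq> 0}"

text \<open>The ideal of the local ring generated by the germs of the homogeneous polynomials \<open>F\<close> and \<open>G\<close>.
  No line avoiding \<open>P\<close> has to be chosen to dehomogenise them: for a linear form \<open>L\<close> not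
  vanishing at \<open>P\<close> and \<open>m = deg F\<close>, one has \<open>A F / S = (A L^m / S) (F / L^m)\<close>.\<close>

definition local_ideal :: "tpoly \<Rightarrow> tpoly \<Rightarrow> complex \<Rightarrow> complex \<Rightarrow> complex \<Rightarrow> tpoly fract set" where
  "local_ideal F G p1 p2 p3 =
     {Fract (A * F + A' * G) S | A A' S d. homogeneous d (A * F) \<and> homogeneous d (A' * G) \<and>
        homogeneous d S \<and> eval3 S p1 p2 p3 \<noteq> 0}"

text \<open>The dimension of the complex vector space \<open>V / W\<close>, as the supremum of the lengths of finite
  families in \<open>V\<close> that are linearly independent modulo \<open>W\<close>.\<close>

definition quotient_dim :: "tpoly fract set \<Rightarrow> tpoly fract set \<Rightarrow> enat" where
  "quotient_dim V W = Sup {enat n | n. \<exists>x. (\<forall>i<n. x i \<in> V) \<and>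
     (\<forall>c. (\<Sum>i<n. Fract (const3 (c i)) 1 * x i) \<in> W \<longrightarrow> (\<forall>i<n. c i = 0))}"

definition intersection_number ::
    "tpoly \<Rightarrow> tpoly \<Rightarrow> complex \<Rightarrow> complex \<Rightarrow> complex \<Rightarrow> enat" where
  "intersection_number F G p1 p2 p3 =
     quotient_dim (local_ring p1 p2 p3) (local_ideal F G p1 p2 p3)"


section \<open>The quartic surface and its plane sections\<close>

text \<open>The triple \<open>(q0, q1, q2)\<close> of coefficients stands for the real quadratic form
  \<open>Q(y0, y1) = q0 y0^2 + q1 y0 y1 + q2 y1^2\<close>.\<close>

type_synonym rqform = "real \<times> real \<times> real"

fun qform :: "rqform \<Rightarrow> 'a::real_field \<Rightarrow> 'a \<Rightarrow> 'a" where
  "qform (q0, q1, q2) y0 y1 = of_real q0 * y0^2 + of_real q1 * y0 * y1 + of_real q2 * y1^2"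

definition fcubic :: "real \<Rightarrow> real \<Rightarrow> real \<Rightarrow> real" where
  "fcubic a b l = l * (l + 1) * (a * l - b)"

text \<open>\<open>Q(\<lambda>, 1)^2 - f(\<lambda>)\<close> as a polynomial in \<open>\<lambda>\<close>.\<close>

fun discr_poly :: "real \<Rightarrow> real \<Rightarrow> rqform \<Rightarrow> real poly" where
  "discr_poly a b (q0, q1, q2) = [:q2, q1, q0:]^2 - [:0, 1:] * [:1, 1:] * [:- b, a:]"

lemma poly_discr_poly: "poly (discr_poly a b Q) l = (qform Q l 1)^2 - fcubic a b l"
  by (cases Q) (simp add: fcubic_def algebra_simps power2_eq_square)

definition quartic_surface :: "real \<Rightarrow> real \<Rightarrow> rqform \<Rightarrow> cp3 set" where
  "quartic_surface a b Q = {pt y0 y1 y2 y3 | y0 y1 y2 y3. (y0, y1, y2, y3) \<noteq> (0, 0, 0, 0) \<and>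
     (y2 * y3 + qform Q y0 y1)^2
       - y0 * y1 * (y0 + y1) * (of_real a * y0 - of_real b * y1) = 0}"

definition real_plane :: "real \<Rightarrow> cp3 set" where
  "real_plane l = {pt y0 y1 y2 y3 | y0 y1 y2 y3. (y0, y1, y2, y3) \<noteq> (0, 0, 0, 0) \<and>
     y0 = of_real l * y1}"

text \<open>The curve in the plane \<open>y0 = \<lambda> y1\<close>, with homogeneous coordinates \<open>(y1 : y2 : y3)\<close>,
  cut out by \<open>F\<close>.\<close>

definition plane_curve :: "real \<Rightarrow> tpoly \<Rightarrow> cp3 set" where
  "plane_curve l F = {pt (of_real l * y1) y1 y2 y3 | y1 y2 y3.
     (y1, y2, y3) \<noteq> (0, 0, 0) \<and> eval3 F y1 y2 y3 = 0}"

definition section_poly :: "real \<Rightarrow> real \<Rightarrow> rqform \<Rightarrow> real \<Rightarrow> tpoly" where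
  "section_poly a b Q l =
     (Y2 * Y3 + const3 (of_real (qform Q l 1)) * Y1^2)^2 - const3 (of_real (fcubic a b l)) * Y1^4"

lemma eval3_section_poly:
  "eval3 (section_poly a b Q l) y1 y2 y3 =
     (y2 * y3 + qform Q (of_real l * y1) y1)^2 - (of_real l * y1) * y1 * (of_real l * y1 + y1) *
       (of_real a * (of_real l * y1) - of_real b * y1)"
  by (cases Q) (simp add: eval3_def section_poly_def const3_def Y1_def Y2_def Y3_def fcubic_def
      algebra_simps power2_eq_square power4_eq_xxxx)


lemma plane_curve_section_poly:
  "plane_curve l (section_poly a b Q l) = quartic_surface a b Q \<inter> real_plane l"
proof (intro equalityI subsetI)
  fix P assume "P \<in> plane_curve l (section_poly a b Q l)"
  then obtain y1 y2 y3 where P: "P = pt (of_real l * y1) y1 y2 y3"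
    and nz: "(y1, y2, y3) \<noteq> (0, 0, 0)" and e: "eval3 (section_poly a b Q l) y1 y2 y3 = 0"
    unfolding plane_curve_def by blast
  from nz have nz': "(of_real l * y1, y1, y2, y3) \<noteq> (0, 0, 0, 0)" by auto
  show "P \<in> quartic_surface a b Q \<inter> real_plane l"
    using P nz' e unfolding eval3_section_poly quartic_surface_def real_plane_def by blast
next
  fix P assume "P \<in> quartic_surface a b Q \<inter> real_plane l"
  then obtain x0 x1 x2 x3 y1 y2 y3 where P: "P = pt x0 x1 x2 x3" "P = pt (of_real l * y1) y1 y2 y3"
    and nzx: "(x0, x1, x2, x3) \<noteq> (0, 0, 0, 0)"
    and nzy: "(of_real l * y1, y1, y2, y3) \<noteq> (0, 0, 0, 0)"
    and x: "(x2 * x3 + qform Q x0 x1)^2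
              - x0 * x1 * (x0 + x1) * (of_real a * x0 - of_real b * x1) = 0"
    unfolding quartic_surface_def real_plane_def by blast
  from P nzx nzy have "proportional (of_real l * y1, y1, y2, y3) (x0, x1, x2, x3)"
    by (auto simp: pt_eq_iff)
  then obtain c where c: "of_real l * y1 = c * x0" "y1 = c * x1" "y2 = c * x2" "y3 = c * x3"
    by (auto elim!: proportionalE)
  have "eval3 (section_poly a b Q l) y1 y2 y3 = c^4 * ((x2 * x3 + qform Q x0 x1)^2
              - x0 * x1 * (x0 + x1) * (of_real a * x0 - of_real b * x1))"
    unfolding eval3_section_poly c(1) unfolding c(2-4)
    by (cases Q) (simp add: algebra_simps power2_eq_square power4_eq_xxxx)
  with x P(2) nzy show "P \<in> plane_curve l (section_poly a b Q l)"
    unfolding plane_curve_def by auto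
qed


section \<open>Touching conics\<close>

definition irreducible_conic :: "real \<Rightarrow> tpoly \<Rightarrow> cp3 set \<Rightarrow> bool" where
  "irreducible_conic l F C \<longleftrightarrow> homogeneous 2 F \<and> irreducible F \<and> C = plane_curve l F"

definition real_touching_conic :: "real \<Rightarrow> real \<Rightarrow> rqform \<Rightarrow> real \<Rightarrow> cp3 set \<Rightarrow> bool" where
  "real_touching_conic a b Q l C \<longleftrightarrow> real_subset C \<and>
     (\<exists>F. irreducible_conic l F C \<and>
        (C \<subseteq> quartic_surface a b Q \<or>
         (\<forall>y1 y2 y3. (y1, y2, y3) \<noteq> (0, 0, 0) \<longrightarrow>
            pt (of_real l * y1) y1 y2 y3 \<in> C \<inter> quartic_surface a b Q \<longrightarrow>
            intersection_number F (section_poly a b Q l) y1 y2 y3 \<ge> 2)))"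

text \<open>The two points are \<open>P_\<infinity> = (0 : 0 : 0 : 1)\<close> and its conjugate \<open>(0 : 0 : 1 : 0)\<close>, written in the
  plane coordinates \<open>(y1 : y2 : y3)\<close>.\<close>

definition orbit_type :: "real \<Rightarrow> real \<Rightarrow> rqform \<Rightarrow> real \<Rightarrow> cp3 set \<Rightarrow> bool" where
  "orbit_type a b Q l C \<longleftrightarrow>
     (\<exists>F. irreducible_conic l F C \<and>
        (C \<subseteq> quartic_surface a b Q \<or>
         (intersection_number F (section_poly a b Q l) 0 0 1 = 4 \<and>
          intersection_number F (section_poly a b Q l) 0 1 0 = 4)))"

end

theory Submission
  imports Defs
begin

text \<open>On \<open>y2 y3 = \<alpha> y1^2\<close> the quartic restricts to \<open>((\<alpha> + q)^2 - f) y1^4\<close>. So either the conic lies on the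
  quartic, or they meet only where \<open>y1 = 0\<close>, i.e. at the two points \<open>(0 : 0 : 1)\<close> and \<open>(0 : 1 : 0)\<close>, each
  with multiplicity 4. Conversely, a conic through one of these points that is not tangent there to
  \<open>y2 = 0\<close> (resp. \<open>y3 = 0\<close>) meets the quartic in multiplicity at most 3, and the two
  tangency conditions leave only \<open>A y1^2 + E y2 y3\<close>. A conic on the quartic lies on
  \<open>(y2 y3 - \<beta> y1^2) (y2 y3 - \<gamma> y1^2) = 0\<close> with complex \<open>\<beta>\<close>, \<open>\<gamma>\<close>, so \<open>y2 y3 / y1^2\<close> is constant on
  it. Invariance under the real structure forces \<open>\<alpha>\<close> to be real.\<close>

section \<open>Homogeneous ternary polynomials\<close>

text \<open>Intersection numbers are suprema over independent families of fractions, so both bounds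
  are brought down to homogeneous polynomials. Upper bound: after passing to a common denominator,
  more than \<open>r\<close> numerators have a nontrivial combination killed by \<open>r\<close>
  functionals that detect the ideal up to a unit of the local ring. Lower bound: restriction to a
  branch of the conic kills \<open>F\<close> and leaves the order of vanishing of \<open>G\<close>.
  The value 4 arises because the quartic becomes a scalar times \<open>Y1 ^ 4\<close> modulo the
  conic, so the powers of \<open>Y1\<close> below the fourth form a basis of the quotient. The bound
  3 is the dimension of the local ring modulo the square of its maximal ideal. Conics on the quartic
  are treated by a rational parametrisation: containment becomes the vanishing of a product of
  polynomials in one variable, hence of one factor.\<close>

lemma const3_0 [simp]: "const3 0 = 0" and const3_1 [simp]: "const3 1 = 1"
  by (simp_all add: const3_def pCons_one)

lemma const3_add: "const3 (c + d) = const3 c + const3 d"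
  and const3_diff: "const3 (c - d) = const3 c - const3 d"
  and const3_uminus: "const3 (- c) = - const3 c"
  and const3_mult: "const3 (c * d) = const3 c * const3 d"
  by (simp_all add: const3_def)

lemma const3_power: "const3 (c ^ n) = const3 c ^ n"
  by (induction n) (simp_all add: const3_mult)

lemma eval3_simps [simp]:
  "eval3 0 y1 y2 y3 = 0" "eval3 1 y1 y2 y3 = 1"
  "eval3 (F + G) y1 y2 y3 = eval3 F y1 y2 y3 + eval3 G y1 y2 y3"
  "eval3 (F - G) y1 y2 y3 = eval3 F y1 y2 y3 - eval3 G y1 y2 y3"
  "eval3 (F * G) y1 y2 y3 = eval3 F y1 y2 y3 * eval3 G y1 y2 y3"
  "eval3 (F ^ n) y1 y2 y3 = eval3 F y1 y2 y3 ^ n"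
  "eval3 (const3 c) y1 y2 y3 = c"
  "eval3 Y1 y1 y2 y3 = y1" "eval3 Y2 y1 y2 y3 = y2" "eval3 Y3 y1 y2 y3 = y3"
  by (simp_all add: eval3_def const3_def Y1_def Y2_def Y3_def)

lemma eval3_sum: "eval3 (\<Sum>i\<in>I. F i) y1 y2 y3 = (\<Sum>i\<in>I. eval3 (F i) y1 y2 y3)"
  by (induction I rule: infinite_finite_induct) simp_all

lemma eval3_prod: "eval3 (\<Prod>i\<in>I. F i) y1 y2 y3 = (\<Prod>i\<in>I. eval3 (F i) y1 y2 y3)"
  by (induction I rule: infinite_finite_induct) simp_all

lemma homogeneous_basic [simp]:
  "homogeneous d 0" "homogeneous 0 1" "homogeneous 0 (const3 c)"
  "homogeneous (Suc 0) Y1" "homogeneous (Suc 0) Y2" "homogeneous (Suc 0) Y3"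
  by (auto simp: homogeneous_def const3_def Y1_def Y2_def Y3_def coeff_pCons split: nat.splits)

lemma homogeneous_add:
  assumes "homogeneous d F" "homogeneous d G" shows "homogeneous d (F + G)"
  using assms unfolding homogeneous_def by (metis add_0 coeff_add)

lemma homogeneous_diff:
  assumes "homogeneous d F" "homogeneous d G" shows "homogeneous d (F - G)"
  using assms unfolding homogeneous_def by (metis diff_0_right coeff_diff)

lemma homogeneous_mult:
  assumes "homogeneous d F" "homogeneous e G" "n = d + e" shows "homogeneous n (F * G)"
  unfolding homogeneous_def
proof (intro allI impI)
  fix i j k
  assume "coeff (coeff (coeff (F * G) k) j) i \<noteq> 0"
  then have "(\<Sum>r\<le>k. \<Sum>s\<le>j. \<Sum>t\<le>i. coeff (coeff (coeff F r) s) t *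
      coeff (coeff (coeff G (k - r)) (j - s)) (i - t)) \<noteq> 0"
    by (simp add: coeff_mult coeff_sum)
  then obtain r where "r \<le> k" and r: "(\<Sum>s\<le>j. \<Sum>t\<le>i. coeff (coeff (coeff F r) s) t *
      coeff (coeff (coeff G (k - r)) (j - s)) (i - t)) \<noteq> 0"
    by (rule sum.not_neutral_contains_not_neutral) simp
  from r obtain s where "s \<le> j" and s: "(\<Sum>t\<le>i. coeff (coeff (coeff F r) s) t *
      coeff (coeff (coeff G (k - r)) (j - s)) (i - t)) \<noteq> 0"
    by (rule sum.not_neutral_contains_not_neutral) simp
  from s obtain t where "t \<le> i" and "coeff (coeff (coeff F r) s) t \<noteq> 0"
      "coeff (coeff (coeff G (k - r)) (j - s)) (i - t) \<noteq> 0"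
    by (rule sum.not_neutral_contains_not_neutral) simp
  with assms have "t + s + r = d" "(i - t) + (j - s) + (k - r) = e"
    unfolding homogeneous_def by blast+
  with assms(3) \<open>r \<le> k\<close> \<open>s \<le> j\<close> \<open>t \<le> i\<close> show "i + j + k = n" by simp
qed

lemma homogeneous_const3_mult:
  assumes "homogeneous d F" shows "homogeneous d (const3 c * F)"
  using homogeneous_mult[OF homogeneous_basic(3) assms] by simp

lemma homogeneous_power:
  assumes "homogeneous d F" "n = d * m" shows "homogeneous n (F ^ m)"
  using assms(2)
  by (induction m arbitrary: n) (auto intro!: homogeneous_mult assms(1))

lemma homogeneous_sum:
  assumes "\<And>i. i \<in> I \<Longrightarrow> homogeneous d (F i)" shows "homogeneous d (\<Sum>i\<in>I. F i)"
  using assms by (induction I rule: infinite_finite_induct) (auto intro: homogeneous_add)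

lemma homogeneous_prod:
  assumes "\<And>i. i \<in> I \<Longrightarrow> homogeneous (d i) (F i)"
  shows "homogeneous (\<Sum>i\<in>I. d i) (\<Prod>i\<in>I. F i)"
  using assms by (induction I rule: infinite_finite_induct) (auto intro: homogeneous_mult)

lemma coeff_monomial3:
  "coeff (coeff (coeff (const3 c * Y1 ^ i * Y2 ^ j * Y3 ^ k) k') j') i' =
     (if i = i' \<and> j = j' \<and> k = k' then c else 0)"
proof -
  have "Y1 ^ i = [:[:monom 1 i:]:]"
    by (induction i) (simp_all add: Y1_def monom_Suc pCons_one monom_0)
  moreover have "Y2 ^ j = [:monom 1 j:]"
    by (induction j) (simp_all add: Y2_def monom_Suc pCons_one monom_0)
  moreover have "Y3 ^ k = monom 1 k"
    by (induction k) (simp_all add: Y3_def monom_Suc)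
  ultimately have "const3 c * Y1 ^ i * Y2 ^ j * Y3 ^ k = monom (monom (monom c i) j) k"
    by (simp add: const3_def smult_monom)
  then show ?thesis by simp
qed

text \<open>Homogeneity fixes the exponent of \<open>Y3\<close> once those of \<open>Y1\<close> and
  \<open>Y2\<close> are chosen; i + j <= d makes the truncated subtraction exact.\<close>

lemma homogeneous_expansion:
  assumes "homogeneous d H"
  shows "H = (\<Sum>(i, j) \<in> {(i, j). i + j \<le> d}.
      const3 (coeff (coeff (coeff H (d - i - j)) j) i) * Y1 ^ i * Y2 ^ j * Y3 ^ (d - i - j))"
    (is "H = ?R")
proof -
  have fin: "finite {(i, j). i + j \<le> d}"
    by (rule finite_subset[of _ "{..d} \<times> {..d}"]) auto
  have "coeff (coeff (coeff ?R k) j) i = coeff (coeff (coeff H k) j) i" for i j k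
  proof -
    have "coeff (coeff (coeff ?R k) j) i = (\<Sum>p \<in> {(i, j). i + j \<le> d}.
        if p = (i, j) then (if d - i - j = k then coeff (coeff (coeff H k) j) i else 0) else 0)"
      unfolding coeff_sum case_prod_beta coeff_monomial3 by (intro sum.cong) auto
    also have "\<dots> = (if i + j \<le> d \<and> d - i - j = k then coeff (coeff (coeff H k) j) i else 0)"
      using fin by (simp add: sum.delta)
    also have "\<dots> = coeff (coeff (coeff H k) j) i"
      using assms unfolding homogeneous_def by fastforce
    finally show ?thesis .
  qed
  then show ?thesis by (simp add: poly_eq_iff)
qed

lemma eval3_scale:
  assumes "homogeneous d H"
  shows "eval3 H (c * y1) (c * y2) (c * y3) = c ^ d * eval3 H y1 y2 y3"
proof -
  have *: "x * (c * y1) ^ i * (c * y2) ^ j * (c * y3) ^ (d - i - j) =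
      c ^ d * (x * y1 ^ i * y2 ^ j * y3 ^ (d - i - j))" if "i + j \<le> d" for i j x
  proof -
    have "x * (c * y1) ^ i * (c * y2) ^ j * (c * y3) ^ (d - i - j) =
      (c ^ i * c ^ j * c ^ (d - i - j)) * (x * y1 ^ i * y2 ^ j * y3 ^ (d - i - j))"
      by (simp only: power_mult_distrib ac_simps)
    also have "c ^ i * c ^ j * c ^ (d - i - j) = c ^ d"
      using that by (simp flip: power_add)
    finally show ?thesis .
  qed
  show ?thesis
    by (subst (1 2) homogeneous_expansion[OF assms])
      (auto simp only: eval3_sum eval3_simps sum_distrib_left case_prod_conv * mem_Collect_eq
        split_paired_all intro!: sum.cong)
qed

section \<open>Membership in plane curves\<close>

lemma pt_eqE:
  assumes "pt x0 x1 x2 x3 = pt y0 y1 y2 y3"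
    and "(x0, x1, x2, x3) \<noteq> (0, 0, 0, 0)" "(y0, y1, y2, y3) \<noteq> (0, 0, 0, 0)"
  obtains c where "x0 = c * y0" "x1 = c * y1" "x2 = c * y2" "x3 = c * y3"
  using assms by (auto simp: pt_eq_iff elim!: proportionalE)

text \<open>\<open>plane_curve\<close> asks only for some representative of the point; by
  homogeneity every representative decides.\<close>

lemma pt_in_plane_curve_iff:
  assumes "homogeneous d F" "(y1, y2, y3) \<noteq> (0, 0, 0)"
  shows "pt (of_real l * y1) y1 y2 y3 \<in> plane_curve l F \<longleftrightarrow> eval3 F y1 y2 y3 = 0"
proof
  assume "pt (of_real l * y1) y1 y2 y3 \<in> plane_curve l F"
  then obtain z1 z2 z3 where eq: "pt (of_real l * y1) y1 y2 y3 = pt (of_real l * z1) z1 z2 z3"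
    and "(z1, z2, z3) \<noteq> (0, 0, 0)" and 0: "eval3 F z1 z2 z3 = 0"
    unfolding plane_curve_def by blast
  with assms(2) obtain c where "y1 = c * z1" "y2 = c * z2" "y3 = c * z3"
    by (auto intro: pt_eqE[OF eq])
  with eval3_scale[OF assms(1), of c z1 z2 z3] 0 show "eval3 F y1 y2 y3 = 0" by simp
qed (use assms in \<open>auto simp: plane_curve_def\<close>)

lemma plane_curve_cong:
  assumes "\<And>y1 y2 y3. eval3 F y1 y2 y3 = 0 \<longleftrightarrow> eval3 G y1 y2 y3 = 0"
  shows "plane_curve l F = plane_curve l G"
  unfolding plane_curve_def using assms by simp

lemma plane_curve_subset_real_plane: "plane_curve l F \<subseteq> real_plane l"
  unfolding plane_curve_def real_plane_def by auto

lemma homogeneous_section_poly: "homogeneous 4 (section_poly a b Q l)"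
  unfolding section_poly_def
  by (intro homogeneous_diff homogeneous_power[of 2 _ _ 2] homogeneous_add homogeneous_const3_mult
      homogeneous_mult[of 1 _ 1] homogeneous_power[of 1]) simp_all

lemma real_structure_pt:
  assumes "(y0, y1, y2, y3) \<noteq> (0, 0, 0, 0)"
  shows "real_structure (pt y0 y1 y2 y3) = pt (cnj y0) (cnj y1) (cnj y3) (cnj y2)"
proof -
  have "proportional (y0, y1, y2, y3) (y0, y1, y2, y3)"
    using assms by (auto simp: proportional_def intro: exI[of _ 1])
  then show ?thesis unfolding pt_def by (simp add: real_structure.abs_eq)
qed

section \<open>The conics \<open>y2 y3 = \<alpha> y1^2\<close>\<close>

definition pencil_conic :: "complex \<Rightarrow> tpoly" where
  "pencil_conic \<alpha> = Y2 * Y3 - const3 \<alpha> * Y1 ^ 2"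

lemma eval3_pencil_conic [simp]: "eval3 (pencil_conic \<alpha>) y1 y2 y3 = y2 * y3 - \<alpha> * y1 ^ 2"
  by (simp add: pencil_conic_def)

lemma homogeneous_pencil_conic: "homogeneous 2 (pencil_conic \<alpha>)"
  unfolding pencil_conic_def
  by (intro homogeneous_diff homogeneous_const3_mult
      homogeneous_mult[of 1 _ 1] homogeneous_power[of 1]) simp_all

text \<open>The polynomial is linear in \<open>Y3\<close>, so one factor is free of
  \<open>Y3\<close> and divides both coefficients. Dividing a nonzero multiple of
  \<open>Y1 ^ 2\<close> makes it free of \<open>Y2\<close>; dividing \<open>Y2\<close> then makes it
  a unit.\<close>

lemma irreducible_pencil_conic:
  assumes "\<alpha> \<noteq> 0" shows "irreducible (pencil_conic \<alpha>)"
proof -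
  have F: "pencil_conic \<alpha> = [:[:[:0, 0, - \<alpha>:]:], [:0, 1:]:]"
    by (simp add: pencil_conic_def Y1_def Y2_def Y3_def const3_def power2_eq_square)
  have unit: "is_unit P" if dvd: "P dvd pencil_conic \<alpha>" and deg: "degree P = 0" for P :: tpoly
  proof -
    obtain p where P: "P = [:p:]" using deg by (metis degree_eq_zeroE)
    have "\<forall>n. p dvd coeff (pencil_conic \<alpha>) n"
      using dvd unfolding P const_poly_dvd_iff .
    from spec[OF this, of 0] spec[OF this, of 1]
    have p: "p dvd [:[:0, 0, - \<alpha>:]:]" "p dvd [:0, 1:]" by (simp_all add: F)
    have "degree p \<le> degree [:[:0, 0, - \<alpha>:]:]" using assms p(1) by (intro dvd_imp_degree_le) auto
    then obtain r where r: "p = [:r:]" by (metis degree_eq_zeroE degree_pCons_0 le_zero_eq)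
    have "\<forall>n. r dvd coeff [:0, 1:] n" using p(2) unfolding r const_poly_dvd_iff .
    from spec[OF this, of 1] have "r dvd 1" by simp
    then show ?thesis unfolding P r by (simp add: is_unit_const_poly_iff)
  qed
  have deg: "degree (pencil_conic \<alpha>) = 1" by (simp add: F)
  show ?thesis
  proof (rule irreducibleI)
    show "pencil_conic \<alpha> \<noteq> 0" using deg by auto
    have "eval3 (pencil_conic \<alpha>) 0 0 0 = 0" by simp
    then show "\<not> is_unit (pencil_conic \<alpha>)"
      by (metis dvdE eval3_simps(2) eval3_simps(5) mult_zero_left zero_neq_one)
    fix P R assume PR: "pencil_conic \<alpha> = P * R"
    have "P \<noteq> 0" "R \<noteq> 0" using PR deg by auto
    then have "degree P = 0 \<or> degree R = 0" using deg PR by (auto simp: degree_mult_eq)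
    then show "is_unit P \<or> is_unit R" using unit[of P] unit[of R] PR by (metis dvd_triv_left dvd_triv_right)
  qed
qed

lemma real_plane_Int_conic:
  "real_plane l \<inter> {pt y0 y1 y2 y3 | y0 y1 y2 y3. (y0, y1, y2, y3) \<noteq> (0, 0, 0, 0) \<and>
     y2 * y3 = of_real \<alpha> * y1 ^ 2} = plane_curve l (pencil_conic (of_real \<alpha>))" (is "_ \<inter> ?S = ?C")
proof (intro equalityI subsetI)
  fix P assume "P \<in> real_plane l \<inter> ?S"
  then obtain x0 x1 x2 x3 y1 y2 y3 where P: "P = pt x0 x1 x2 x3" "P = pt (of_real l * y1) y1 y2 y3"
    and nz: "(x0, x1, x2, x3) \<noteq> (0, 0, 0, 0)" "(of_real l * y1, y1, y2, y3) \<noteq> (0, 0, 0, 0)"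
    and x: "x2 * x3 = of_real \<alpha> * x1 ^ 2"
    unfolding real_plane_def by blast
  obtain c where c: "y1 = c * x1" "y2 = c * x2" "y3 = c * x3"
    using pt_eqE[of "of_real l * y1" y1 y2 y3 x0 x1 x2 x3] P nz by metis
  have "y2 * y3 - of_real \<alpha> * y1 ^ 2 = c ^ 2 * (x2 * x3 - of_real \<alpha> * x1 ^ 2)"
    unfolding c by (simp add: algebra_simps power2_eq_square)
  with P(2) nz x show "P \<in> ?C" unfolding plane_curve_def by auto
next
  fix P assume P: "P \<in> ?C"
  then obtain y1 y2 y3 where "P = pt (of_real l * y1) y1 y2 y3" "(y1, y2, y3) \<noteq> (0, 0, 0)"
    "y2 * y3 = of_real \<alpha> * y1 ^ 2"
    unfolding plane_curve_def by auto
  then have "P \<in> ?S" by blast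
  then show "P \<in> real_plane l \<inter> ?S" using P plane_curve_subset_real_plane by blast
qed

text \<open>A test point that recognises the parameter: it yields injectivity of the parametrisation
  and, together with its conjugate, reality of the parameter.\<close>

lemma pencil_point_iff:
  "pt (of_real l) 1 1 \<alpha> \<in> plane_curve l (pencil_conic \<beta>) \<longleftrightarrow> \<alpha> = \<beta>"
  using pt_in_plane_curve_iff[OF homogeneous_pencil_conic, of 1 1 \<alpha> l] by simp

lemma real_subset_pencil_iff:
  "real_subset (plane_curve l (pencil_conic \<alpha>)) \<longleftrightarrow> \<alpha> \<in> \<real>" (is "real_subset ?C \<longleftrightarrow> _")
proof
  assume real: "real_subset ?C"
  have "real_structure (pt (of_real l) 1 1 \<alpha>) \<in> ?C"
    using real imageI[of "pt (of_real l) 1 1 \<alpha>" ?C real_structure]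
    unfolding real_subset_def by (simp add: pencil_point_iff)
  then have "pt (of_real l) 1 (cnj \<alpha>) 1 \<in> ?C" by (simp add: real_structure_pt)
  then have "cnj \<alpha> = \<alpha>"
    using pt_in_plane_curve_iff[OF homogeneous_pencil_conic, of 1 "cnj \<alpha>" 1 l] by simp
  then show "\<alpha> \<in> \<real>" by (simp add: Reals_cnj_iff)
next
  assume "\<alpha> \<in> \<real>"
  then have cnj: "cnj \<alpha> = \<alpha>" by (simp add: Reals_cnj_iff)
  \<comment> \<open>Involutivity is included because it supplies \<open>real_structure P\<close> as
    the preimage of \<open>P\<close>.\<close>
  have *: "real_structure P \<in> ?C \<and> real_structure (real_structure P) = P" if "P \<in> ?C" for P
  proof -
    obtain y1 y2 y3 where P: "P = pt (of_real l * y1) y1 y2 y3" and nz: "(y1, y2, y3) \<noteq> (0, 0, 0)"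
      and e: "y2 * y3 - \<alpha> * y1 ^ 2 = 0"
      using \<open>P \<in> ?C\<close> unfolding plane_curve_def by auto
    have "cnj (y2 * y3 - \<alpha> * y1 ^ 2) = 0" unfolding e by simp
    then have "cnj y3 * cnj y2 - \<alpha> * cnj y1 ^ 2 = 0" by (simp add: cnj mult.commute)
    moreover have "real_structure P = pt (of_real l * cnj y1) (cnj y1) (cnj y3) (cnj y2)"
      unfolding P using nz by (subst real_structure_pt) auto
    moreover have "real_structure (pt (of_real l * cnj y1) (cnj y1) (cnj y3) (cnj y2)) = P"
      unfolding P using nz by (subst real_structure_pt) auto
    ultimately show ?thesis using nz unfolding plane_curve_def by auto
  qed
  show "real_subset ?C" unfolding real_subset_def
  proof (intro equalityI subsetI)
    fix P assume "P \<in> ?C"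
    then show "P \<in> real_structure ` ?C" using * by (intro image_eqI[of _ _ "real_structure P"]) auto
  qed (use * in auto)
qed

section \<open>Bounding intersection numbers\<close>

text \<open>Gaussian elimination: the last equation is solved for a pivot unknown \<open>p\<close>,
  and the remaining equations are solved in the other unknowns.\<close>

lemma homogeneous_linear_system:
  fixes M :: "nat \<Rightarrow> 'i \<Rightarrow> 'a::field"
  assumes "finite I" "r < card I"
  shows "\<exists>c. (\<exists>i\<in>I. c i \<noteq> 0) \<and> (\<forall>j<r. (\<Sum>i\<in>I. c i * M j i) = 0)"
  using assms
proof (induction r arbitrary: I M)
  case 0
  then have "I \<noteq> {}" by auto
  then show ?case by (intro exI[of _ "\<lambda>_. 1"]) auto
next
  case (Suc r)
  show ?case
  proof (cases "\<forall>i\<in>I. M r i = 0")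
    case True
    with Suc.IH[of I M] Suc.prems show ?thesis
      by (auto simp: less_Suc_eq)
  next
    case False
    then obtain p where p: "p \<in> I" "M r p \<noteq> 0" by blast
    define J where "J = I - {p}"
    have J: "finite J" "r < card J" "I = insert p J" "p \<notin> J"
      using Suc.prems p unfolding J_def by auto
    \<comment> \<open>The system after eliminating \<open>p\<close>; its row \<open>r\<close> is
      zero.\<close>
    define N where "N = (\<lambda>j i. M j i - M j p * M r i / M r p)"
    obtain c where c: "\<exists>i\<in>J. c i \<noteq> 0" "\<forall>j<r. (\<Sum>i\<in>J. c i * N j i) = 0"
      using Suc.IH[OF J(1,2), of N] by blast
    define e where "e = c(p := - (\<Sum>i\<in>J. c i * M r i) / M r p)"
    have ep: "e p = - (\<Sum>i\<in>J. c i * M r i) / M r p" and eJ: "\<And>i. i \<in> J \<Longrightarrow> e i = c i"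
      using J(4) by (auto simp: e_def)
    have sum: "(\<Sum>i\<in>I. e i * M j i) = (\<Sum>i\<in>J. c i * N j i)" for j
    proof -
      have "(\<Sum>i\<in>I. e i * M j i) = e p * M j p + (\<Sum>i\<in>J. c i * M j i)"
        using J eJ by simp
      also have "\<dots> = (\<Sum>i\<in>J. c i * N j i)"
        unfolding ep N_def
        by (simp add: right_diff_distrib sum_subtractf sum_distrib_left sum_divide_distrib ac_simps)
      finally show ?thesis .
    qed
    have "(\<Sum>i\<in>J. c i * N r i) = 0" using p by (simp add: N_def)
    with c(2) have "\<forall>j<Suc r. (\<Sum>i\<in>I. e i * M j i) = 0"
      unfolding sum by (auto simp: less_Suc_eq)
    moreover have "\<exists>i\<in>I. e i \<noteq> 0" using c(1) eJ J(3) by auto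
    ultimately show ?thesis by blast
  qed
qed

text \<open>The degree \<open>d\<close> piece of the ideal (F, G). Homogeneity is imposed on the two
  products, the form in which \<open>local_ideal\<close> asks for it.\<close>

definition hom_ideal :: "tpoly \<Rightarrow> tpoly \<Rightarrow> nat \<Rightarrow> tpoly set" where
  "hom_ideal F G d =
     {A * F + A' * G | A A'. homogeneous d (A * F) \<and> homogeneous d (A' * G)}"

section \<open>Closure properties of the graded pieces of the ideal\<close>

lemma hom_ideal_0 [simp]: "0 \<in> hom_ideal F G d"
  unfolding hom_ideal_def by (rule CollectI, rule exI[of _ 0], rule exI[of _ 0]) simp

lemma hom_ideal_left: "homogeneous d F \<Longrightarrow> F \<in> hom_ideal F G d"
  unfolding hom_ideal_def by (rule CollectI, rule exI[of _ 1], rule exI[of _ 0]) simp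

lemma hom_ideal_right: "homogeneous d G \<Longrightarrow> G \<in> hom_ideal F G d"
  unfolding hom_ideal_def by (rule CollectI, rule exI[of _ 0], rule exI[of _ 1]) simp

lemma hom_ideal_add:
  assumes "H \<in> hom_ideal F G d" "H' \<in> hom_ideal F G d"
  shows "H + H' \<in> hom_ideal F G d"
proof -
  obtain A A' where A: "H = A * F + A' * G" "homogeneous d (A * F)" "homogeneous d (A' * G)"
    using assms(1) unfolding hom_ideal_def by blast
  obtain B B' where B: "H' = B * F + B' * G" "homogeneous d (B * F)" "homogeneous d (B' * G)"
    using assms(2) unfolding hom_ideal_def by blast
  have "H + H' = (A + B) * F + (A' + B') * G" "homogeneous d ((A + B) * F)"
    "homogeneous d ((A' + B') * G)"
    using A B by (simp_all add: algebra_simps homogeneous_add)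
  then show ?thesis unfolding hom_ideal_def by blast
qed

lemma hom_ideal_mult:
  assumes "H \<in> hom_ideal F G d" "homogeneous e M" "n = e + d"
  shows "M * H \<in> hom_ideal F G n"
proof -
  obtain A A' where A: "H = A * F + A' * G" "homogeneous d (A * F)" "homogeneous d (A' * G)"
    using assms(1) unfolding hom_ideal_def by blast
  have "M * H = (M * A) * F + (M * A') * G" unfolding A(1) by (simp add: algebra_simps)
  moreover have "homogeneous n ((M * A) * F)" "homogeneous n ((M * A') * G)"
    using homogeneous_mult[OF assms(2) A(2) assms(3)] homogeneous_mult[OF assms(2) A(3) assms(3)]
    by (simp_all add: mult.assoc)
  ultimately show ?thesis unfolding hom_ideal_def by blast
qed

lemma hom_ideal_const3_mult:
  "H \<in> hom_ideal F G d \<Longrightarrow> const3 c * H \<in> hom_ideal F G d"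
  by (rule hom_ideal_mult[where e = 0]) simp_all

lemma hom_ideal_diff:
  assumes "H \<in> hom_ideal F G d" "H' \<in> hom_ideal F G d"
  shows "H - H' \<in> hom_ideal F G d"
  using hom_ideal_add[OF assms(1) hom_ideal_const3_mult[OF assms(2), of "-1"]]
  by (simp add: const3_uminus)

lemma hom_ideal_sum:
  assumes "\<And>i. i \<in> I \<Longrightarrow> H i \<in> hom_ideal F G d"
  shows "(\<Sum>i\<in>I. H i) \<in> hom_ideal F G d"
  using assms by (induction I rule: infinite_finite_induct) (auto intro: hom_ideal_add)

lemma sum_Fract:
  assumes "S \<noteq> 0"
  shows "(\<Sum>i\<in>I. Fract (const3 (c i)) 1 * Fract (H i) S) = Fract (\<Sum>i\<in>I. const3 (c i) * H i) S"
  using assms by (induction I rule: infinite_finite_induct) (auto simp: Zero_fract_def eq_fract algebra_simps)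

text \<open>Since the local ring is obtained by inverting the polynomials \<open>T\<close> that do not vanish at the
  point, it suffices to find, in each degree, \<open>r\<close> linear functionals whose common zeros become
  members of the ideal after multiplication by such a \<open>T\<close>.\<close>

lemma intersection_number_le:
  assumes "\<And>d. \<exists>\<psi> :: nat \<Rightarrow> tpoly \<Rightarrow> complex.
      (\<forall>j H H'. \<psi> j (H + H') = \<psi> j H + \<psi> j H') \<and> (\<forall>j c H. \<psi> j (const3 c * H) = c * \<psi> j H) \<and>
      (\<forall>H. homogeneous d H \<longrightarrow> (\<forall>j<r. \<psi> j H = 0) \<longrightarrow>
        (\<exists>e T. homogeneous e T \<and> eval3 T p1 p2 p3 \<noteq> 0 \<and> T * H \<in> hom_ideal F G (d + e)))"
  shows "intersection_number F G p1 p2 p3 \<le> enat r"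
  unfolding intersection_number_def quotient_dim_def
proof (rule Sup_least, clarify)
  fix n and x :: "nat \<Rightarrow> tpoly fract"
  assume V: "\<forall>i<n. x i \<in> local_ring p1 p2 p3"
    and indep: "\<forall>c. (\<Sum>i<n. Fract (const3 (c i)) 1 * x i) \<in> local_ideal F G p1 p2 p3 \<longrightarrow>
      (\<forall>i<n. c i = 0)"
  have "\<forall>i\<in>{..<n}. \<exists>A S d. x i = Fract A S \<and> homogeneous d A \<and> homogeneous d S \<and> eval3 S p1 p2 p3 \<noteq> 0"
    using V unfolding local_ring_def by blast
  then obtain A S d where x: "\<And>i. i < n \<Longrightarrow> x i = Fract (A i) (S i)"
    and hA: "\<And>i. i < n \<Longrightarrow> homogeneous (d i) (A i)" and hS: "\<And>i. i < n \<Longrightarrow> homogeneous (d i) (S i)"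
    and eS: "\<And>i. i < n \<Longrightarrow> eval3 (S i) p1 p2 p3 \<noteq> 0"
    unfolding lessThan_iff bchoice_iff by (metis lessThan_iff)
  \<comment> \<open>All fractions get the common denominator \<open>P\<close>, with numerators
    \<open>H i\<close> of one degree \<open>D\<close>, so that a single set of functionals
    applies.\<close>
  define D where "D = (\<Sum>i<n. d i)"
  define P where "P = (\<Prod>i<n. S i)"
  define H where "H = (\<lambda>i. A i * (\<Prod>k\<in>{..<n} - {i}. S k))"
  have hP: "homogeneous D P" unfolding P_def D_def using hS by (intro homogeneous_prod) auto
  have eP: "eval3 P p1 p2 p3 \<noteq> 0" unfolding P_def eval3_prod using eS by simp
  then have P0: "P \<noteq> 0" by auto
  have hH: "homogeneous D (H i)" if "i < n" for i
    unfolding H_def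
  proof (rule homogeneous_mult[OF hA[OF that]])
    show "homogeneous (\<Sum>k\<in>{..<n} - {i}. d k) (\<Prod>k\<in>{..<n} - {i}. S k)"
      using hS by (intro homogeneous_prod) auto
    show "D = d i + (\<Sum>k\<in>{..<n} - {i}. d k)" unfolding D_def using that by (simp add: sum.remove)
  qed
  have xH: "x i = Fract (H i) P" if "i < n" for i
  proof -
    have "P = S i * (\<Prod>k\<in>{..<n} - {i}. S k)" unfolding P_def using that by (simp add: prod.remove)
    moreover from this P0 have "S i \<noteq> 0" by auto
    ultimately show ?thesis unfolding x[OF that] H_def using P0 by (simp add: eq_fract)
  qed
  obtain \<psi> :: "nat \<Rightarrow> tpoly \<Rightarrow> complex" where \<psi>_add: "\<And>j H H'. \<psi> j (H + H') = \<psi> j H + \<psi> j H'"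
    and \<psi>_mult: "\<And>j c H. \<psi> j (const3 c * H) = c * \<psi> j H"
    and \<psi>: "\<And>H. homogeneous D H \<Longrightarrow> (\<forall>j<r. \<psi> j H = 0) \<Longrightarrow>
        \<exists>e T. homogeneous e T \<and> eval3 T p1 p2 p3 \<noteq> 0 \<and> T * H \<in> hom_ideal F G (D + e)"
    using assms[of D] by blast
  have \<psi>_0: "\<psi> j 0 = 0" for j using \<psi>_mult[of j 0 0] by simp
  have \<psi>_sum: "\<psi> j (\<Sum>i\<in>I. const3 (c i) * H i) = (\<Sum>i\<in>I. c i * \<psi> j (H i))"
    for j c and I :: "nat set"
    by (induction I rule: infinite_finite_induct) (simp_all add: \<psi>_0 \<psi>_add \<psi>_mult)
  show "enat n \<le> enat r"
  proof (rule ccontr)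
    assume "\<not> enat n \<le> enat r"
    then have "r < card {..<n}" by simp
    then obtain c where c: "\<exists>i\<in>{..<n}. c i \<noteq> 0" "\<forall>j<r. (\<Sum>i<n. c i * \<psi> j (H i)) = 0"
      using homogeneous_linear_system[of "{..<n}" r "\<lambda>j i. \<psi> j (H i)"] by auto
    define K where "K = (\<Sum>i<n. const3 (c i) * H i)"
    have hK: "homogeneous D K"
      unfolding K_def using hH by (intro homogeneous_sum homogeneous_const3_mult) auto
    have "\<forall>j<r. \<psi> j K = 0" using c(2) unfolding K_def \<psi>_sum .
    from \<psi>[OF hK this] obtain e T where T: "homogeneous e T" "eval3 T p1 p2 p3 \<noteq> 0"
      and TK: "T * K \<in> hom_ideal F G (D + e)" by blast
    have "T \<noteq> 0" using T(2) by auto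
    have "(\<Sum>i<n. Fract (const3 (c i)) 1 * x i) = (\<Sum>i<n. Fract (const3 (c i)) 1 * Fract (H i) P)"
      using xH by (intro sum.cong) auto
    also have "\<dots> = Fract K P" unfolding K_def sum_Fract[OF P0] ..
    \<comment> \<open>The fraction is extended by \<open>T\<close>: the numerator enters the ideal,
      and the denominator still does not vanish at the point.\<close>
    also have "\<dots> = Fract (T * K) (T * P)" using P0 \<open>T \<noteq> 0\<close> by (simp add: eq_fract)
    also have "\<dots> \<in> local_ideal F G p1 p2 p3"
    proof -
      have "homogeneous (D + e) (T * P)" by (rule homogeneous_mult[OF T(1) hP]) simp
      moreover have "eval3 (T * P) p1 p2 p3 \<noteq> 0" using T(2) eP by simp
      moreover obtain A A' where "T * K = A * F + A' * G"
        "homogeneous (D + e) (A * F)" "homogeneous (D + e) (A' * G)"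
        using TK unfolding hom_ideal_def by blast
      ultimately show ?thesis
        unfolding local_ideal_def mem_Collect_eq
        by (intro exI[of _ A] exI[of _ A'] exI[of _ "T * P"] exI[of _ "D + e"]) simp
    qed
    finally have "\<forall>i<n. c i = 0" using indep by blast
    with c(1) show False by auto
  qed
qed

text \<open>Here \<open>\<phi>\<close> is the substitution of a parametrised branch of the curve \<open>F = 0\<close> at the point, with
  \<open>Y1\<close> as the parameter.\<close>

lemma intersection_number_ge:
  fixes \<phi> :: "tpoly \<Rightarrow> complex poly"
  assumes add: "\<And>H H'. \<phi> (H + H') = \<phi> H + \<phi> H'" and mult: "\<And>H H'. \<phi> (H * H') = \<phi> H * \<phi> H'"
    and const: "\<And>c. \<phi> (const3 c) = [:c:]" and eval: "\<And>H. poly (\<phi> H) 0 = eval3 H 0 p2 p3"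
    and Y1: "\<phi> Y1 = [:0, 1:]" and W: "\<phi> W = [:t:]" "t \<noteq> 0" "homogeneous 1 W"
    and F: "\<phi> F = 0" and G: "[:0, 1:] ^ r dvd \<phi> G"
  shows "intersection_number F G 0 p2 p3 \<ge> enat r"
  unfolding intersection_number_def quotient_dim_def
proof (rule Sup_upper, rule CollectI, intro exI[of _ r] conjI refl)
  have eW: "eval3 W 0 p2 p3 \<noteq> 0" using eval[of W] W by simp
  then have W0: "W \<noteq> 0" by auto
  \<comment> \<open>The powers of the local coordinate \<open>Y1\<close> / \<open>W\<close> below
    the \<open>r\<close>-th, over a common denominator.\<close>
  define x where "x = (\<lambda>i::nat. Fract (Y1 ^ i * W ^ (r - i)) (W ^ r))"
  have pow: "\<phi> (H ^ n) = \<phi> H ^ n" for H n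
    using const[of 1] by (induction n) (simp_all add: mult pCons_one)
  have sum: "\<phi> (\<Sum>i\<in>I. const3 (c i) * H i) = (\<Sum>i\<in>I. smult (c i) (\<phi> (H i)))" for I :: "nat set" and c H
    using const[of 0] by (induction I rule: infinite_finite_induct) (simp_all add: add mult const)
  show "\<exists>x. (\<forall>i<r. x i \<in> local_ring 0 p2 p3) \<and>
    (\<forall>c. (\<Sum>i<r. Fract (const3 (c i)) 1 * x i) \<in> local_ideal F G 0 p2 p3 \<longrightarrow> (\<forall>i<r. c i = 0))"
  proof (rule exI[of _ x], intro conjI allI impI)
    fix i assume "i < r"
    have "homogeneous r (Y1 ^ i * W ^ (r - i))"
      using \<open>i < r\<close> homogeneous_power[OF W(3), of "r - i" "r - i"] homogeneous_power[of 1 Y1 i i]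
      by (intro homogeneous_mult[of i _ "r - i"]) auto
    moreover have "homogeneous r (W ^ r)" by (rule homogeneous_power[OF W(3)]) simp
    moreover have "eval3 (W ^ r) 0 p2 p3 \<noteq> 0" using eW by simp
    ultimately show "x i \<in> local_ring 0 p2 p3" unfolding x_def local_ring_def by blast
  next
    fix c :: "nat \<Rightarrow> complex" and i
    assume mem: "(\<Sum>i<r. Fract (const3 (c i)) 1 * x i) \<in> local_ideal F G 0 p2 p3" and "i < r"
    define K where "K = (\<Sum>i<r. const3 (c i) * (Y1 ^ i * W ^ (r - i)))"
    have "(\<Sum>i<r. Fract (const3 (c i)) 1 * x i) = Fract K (W ^ r)"
      unfolding K_def x_def using W0 by (subst sum_Fract) auto
    with mem obtain A A' S where "Fract K (W ^ r) = Fract (A * F + A' * G) S"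
      and eS: "eval3 S 0 p2 p3 \<noteq> 0"
      unfolding local_ideal_def by auto
    moreover have "S \<noteq> 0" using eS by auto
    ultimately have "K * S = (A * F + A' * G) * W ^ r" using W0 by (simp add: eq_fract)
    then have "\<phi> (K * S) = \<phi> ((A * F + A' * G) * W ^ r)" by (rule arg_cong)
    then have "\<phi> K * \<phi> S = \<phi> A' * \<phi> G * \<phi> W ^ r"
      by (simp only: mult add F pow mult_zero_right add_0)
    then have dvd: "[:0, 1:] ^ r dvd \<phi> K * \<phi> S" using G by (simp add: dvd_mult dvd_mult2)
    have "poly (\<phi> S) 0 \<noteq> 0" using eS eval by simp
    \<comment> \<open>\<open>S\<close> is a unit at the point, so the full \<open>r\<close>-th power
      of the parameter passes to \<open>\<phi> K\<close>, which has no terms of degree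
      \<open>r\<close> or more.\<close>
    then have "order 0 (\<phi> S) = 0" "\<phi> S \<noteq> 0" by (auto simp: order_root)
    then have "[:0, 1:] ^ r dvd \<phi> K"
      using dvd order_divides[of 0 r "\<phi> K"] order_divides[of 0 r "\<phi> K * \<phi> S"]
      by (cases "\<phi> K = 0") (simp_all add: order_mult)
    then obtain M where M: "\<phi> K = [:0, 1:] ^ r * M" by blast
    have X: "[:0, 1:] ^ n = monom (1 :: complex) n" for n by (simp add: monom_altdef)
    have "\<phi> K = (\<Sum>i<r. monom (c i * t ^ (r - i)) i)"
      unfolding K_def sum mult pow Y1 W
      by (intro sum.cong refl) (simp add: X poly_const_pow mult.commute smult_monom)
    then have "coeff (\<phi> K) i = c i * t ^ (r - i)"
      using \<open>i < r\<close> by (simp add: coeff_sum)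
    moreover have "coeff (\<phi> K) i = 0"
      using \<open>i < r\<close> unfolding M X by (simp add: coeff_monom_mult)
    ultimately show "c i = 0" using W(2) by simp
  qed
qed

section \<open>The points \<open>(0 : 0 : 1)\<close> and \<open>(0 : 1 : 0)\<close>\<close>

text \<open>Treats both points at once: \<open>Y1 / W\<close> and \<open>U / W\<close> are local coordinates at
  \<open>(0 : p2 : p3)\<close>.\<close>

definition vertex_frame :: "tpoly \<Rightarrow> tpoly \<Rightarrow> complex \<Rightarrow> complex \<Rightarrow> bool" where
  "vertex_frame U W p2 p3 \<longleftrightarrow>
     U = Y2 \<and> W = Y3 \<and> p2 = 0 \<and> p3 \<noteq> 0 \<or> U = Y3 \<and> W = Y2 \<and> p2 \<noteq> 0 \<and> p3 = 0"

lemma vertex_frameD: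
  assumes "vertex_frame U W p2 p3"
  shows "homogeneous 1 U" "homogeneous 1 W" "eval3 U 0 p2 p3 = 0" "eval3 W 0 p2 p3 \<noteq> 0"
  using assms by (auto simp: vertex_frame_def)

section \<open>Expansions and branch substitutions in a vertex frame\<close>

lemma finite_exponents: "finite {(i, j). i + j \<le> (d :: nat)}"
  by (rule finite_subset[of _ "{..d} \<times> {..d}"]) auto

text \<open>The coefficients \<open>cf\<close> are linear in all \<open>H\<close>, homogeneous or
  not, since they are to provide the functionals of \<open>intersection_number_le\<close>. The
  degree \<open>d\<close> is fixed beforehand because it enters the exponent of
  \<open>W\<close>.\<close>

lemma vertex_frame_expansion:
  assumes "vertex_frame U W p2 p3"
  obtains cf :: "tpoly \<Rightarrow> nat \<Rightarrow> nat \<Rightarrow> complex"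
  where "\<And>H H' i j. cf (H + H') i j = cf H i j + cf H' i j"
    and "\<And>c H i j. cf (const3 c * H) i j = c * cf H i j"
    and "\<And>H. homogeneous d H \<Longrightarrow> H = (\<Sum>(i, j) \<in> {(i, j). i + j \<le> d}.
           const3 (cf H i j) * (Y1 ^ i * U ^ j * W ^ (d - i - j)))"
proof -
  have smult: "coeff (coeff (coeff (const3 c * H) k) j) i = c * coeff (coeff (coeff H k) j) i"
    for c H i j k by (simp add: const3_def)
  show thesis
  proof (cases "U = Y2")
    case True
    then have "W = Y3" using assms by (auto simp: vertex_frame_def Y2_def Y3_def)
    show thesis
    proof (rule that[of "\<lambda>H i j. coeff (coeff (coeff H (d - i - j)) j) i"])
      fix H assume "homogeneous d H"
      from homogeneous_expansion[OF this] show "H = (\<Sum>(i, j) \<in> {(i, j). i + j \<le> d}.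
          const3 (coeff (coeff (coeff H (d - i - j)) j) i) * (Y1 ^ i * U ^ j * W ^ (d - i - j)))"
        unfolding True \<open>W = Y3\<close> mult.assoc .
    qed (simp_all add: smult)
  next
    case False
    then have UW: "U = Y3" "W = Y2" using assms by (auto simp: vertex_frame_def)
    show thesis
    proof (rule that[of "\<lambda>H i j. coeff (coeff (coeff H j) (d - i - j)) i"])
      fix H assume "homogeneous d H"
      note homogeneous_expansion[OF this]
      also have "(\<Sum>(i, j) \<in> {(i, j). i + j \<le> d}.
          const3 (coeff (coeff (coeff H (d - i - j)) j) i) * Y1 ^ i * Y2 ^ j * Y3 ^ (d - i - j)) =
        (\<Sum>(i, j) \<in> {(i, j). i + j \<le> d}.
          const3 (coeff (coeff (coeff H j) (d - i - j)) i) * (Y1 ^ i * U ^ j * W ^ (d - i - j)))"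
        unfolding UW
        \<comment> \<open>The reindexing is the involution that exchanges the exponents of
          \<open>Y2\<close> and \<open>Y3\<close>.\<close>
        by (rule sum.reindex_bij_witness[of _ "\<lambda>(i, j). (i, d - i - j)" "\<lambda>(i, j). (i, d - i - j)"])
          (auto simp: mult_ac)
      finally show "H = (\<Sum>(i, j) \<in> {(i, j). i + j \<le> d}.
          const3 (coeff (coeff (coeff H j) (d - i - j)) i) * (Y1 ^ i * U ^ j * W ^ (d - i - j)))" .
    qed (simp_all add: smult)
  qed
qed

text \<open>The branch of \<open>U * W\<close> = \<alpha> \<open>Y1 ^ 2\<close> through the vertex:
  with \<open>Y1\<close> as parameter and \<open>W\<close> frozen at its nonzero value
  \<open>t\<close>, the equation determines \<open>U\<close>.\<close>

lemma vertex_frame_substitution: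
  assumes "vertex_frame U W p2 p3"
  obtains \<phi> t where "\<And>H H'. \<phi> (H + H') = \<phi> H + \<phi> H'" "\<And>H H'. \<phi> (H * H') = \<phi> H * \<phi> H'"
    "\<And>c. \<phi> (const3 c) = [:c:]" "\<And>H. poly (\<phi> H) 0 = eval3 H 0 p2 p3"
    "\<phi> Y1 = [:0, 1:]" "\<phi> W = [:t:]" "t \<noteq> 0" "\<phi> U = [:0, 0, \<alpha> / t:]"
proof (cases "U = Y2")
  case True
  then have "W = Y3" "p2 = 0" "p3 \<noteq> 0" using assms by (auto simp: vertex_frame_def Y2_def Y3_def)
  show thesis
  proof (rule that[of "\<lambda>H. poly (poly H [:[:p3:]:]) [:0, 0, \<alpha> / p3:]" p3])
    fix H
    have "poly (poly P [:0, 0, \<alpha> / p3:]) 0 = poly (poly P [:0:]) 0" for P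
      by (induction P) simp_all
    then show "poly (poly (poly H [:[:p3:]:]) [:0, 0, \<alpha> / p3:]) 0 = eval3 H 0 p2 p3"
      using \<open>p2 = 0\<close> by (simp add: eval3_def)
  qed (simp_all add: True \<open>W = Y3\<close> \<open>p3 \<noteq> 0\<close> const3_def Y1_def Y2_def Y3_def)
next
  case False
  then have "U = Y3" "W = Y2" "p3 = 0" "p2 \<noteq> 0" using assms by (auto simp: vertex_frame_def)
  show thesis
  proof (rule that[of "\<lambda>H. poly (poly H [:[:0, 0, \<alpha> / p2:]:]) [:p2:]" p2])
    fix H
    show "poly (poly (poly H [:[:0, 0, \<alpha> / p2:]:]) [:p2:]) 0 = eval3 H 0 p2 p3"
      using \<open>p3 = 0\<close> by (induction H) (simp_all add: eval3_def)
  qed (simp_all add: \<open>U = Y3\<close> \<open>W = Y2\<close> \<open>p2 \<noteq> 0\<close> const3_def Y1_def Y2_def Y3_def)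
qed

text \<open>Modulo \<open>F\<close>, \<open>U * W\<close> becomes \<alpha> \<open>Y1 ^ 2\<close> and
  \<open>G\<close> a nonzero multiple of \<open>Y1 ^ 4\<close>. The factor \<open>W ^ d\<close>
  gives every \<open>U\<close> a partner, so each monomial reduces to powers of \<open>Y1\<close>
  and \<open>W\<close>; only the coefficients of \<open>Y1 ^ m\<close> with m < 4 have to be
  killed.\<close>

lemma intersection_number_pencil_le:
  assumes frame: "vertex_frame U W p2 p3"
    and F: "F = U * W - const3 \<alpha> * Y1 ^ 2"
    and G: "G = (U * W + const3 q * Y1 ^ 2) ^ 2 - const3 f * Y1 ^ 4"
    and k: "(\<alpha> + q) ^ 2 \<noteq> f"
  shows "intersection_number F G 0 p2 p3 \<le> enat 4"
proof (rule intersection_number_le)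
  fix d
  note hom = vertex_frameD(1,2)[OF frame]
  note homW = homogeneous_power[OF hom(2)] and homY = homogeneous_power[OF homogeneous_basic(4)]
  have homYW: "homogeneous n (Y1 ^ a * W ^ b)" if "n = a + b" for n a b
    using that by (intro homogeneous_mult[of a _ b] homY homW) simp_all
  have hF: "homogeneous 2 F" unfolding F
    by (intro homogeneous_diff homogeneous_const3_mult homogeneous_mult[OF hom] homY) simp_all
  have hG: "homogeneous 4 G" unfolding G
    by (intro homogeneous_diff homogeneous_add homogeneous_const3_mult homogeneous_mult[OF hom] homY
        homogeneous_power[where d = 2]) simp_all
  define k where "k = (\<alpha> + q) ^ 2 - f"
  \<comment> \<open>Write \<open>U * W\<close> as \<open>F\<close> plus \<alpha>
    \<open>Y1 ^ 2\<close> inside the square of \<open>G\<close> and expand.\<close>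
  have "const3 k * Y1 ^ 4 = G - (F + const3 (\<alpha> + q + (\<alpha> + q)) * Y1 ^ 2) * F"
    unfolding k_def F G const3_diff const3_add const3_mult const3_power
    by (simp add: algebra_simps power2_eq_square power4_eq_xxxx)
  also have "\<dots> \<in> hom_ideal F G 4"
    by (intro hom_ideal_diff hom_ideal_right hG hom_ideal_mult[OF hom_ideal_left[OF hF], where e = 2]
        homogeneous_add hF homogeneous_const3_mult homY) simp_all
  finally have "const3 (inverse k) * (const3 k * Y1 ^ 4) \<in> hom_ideal F G 4"
    by (rule hom_ideal_const3_mult)
  moreover have "const3 (inverse k) * const3 k = 1"
    using k by (simp add: k_def flip: const3_mult)
  ultimately have Y4: "Y1 ^ 4 \<in> hom_ideal F G 4" by (simp flip: mult.assoc)
  have pow: "(U * W) ^ j - const3 (\<alpha> ^ j) * Y1 ^ (2 * j) \<in> hom_ideal F G (2 * j)" for j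
  proof (induction j)
    case (Suc j)
    have "(U * W) ^ Suc j - const3 (\<alpha> ^ Suc j) * Y1 ^ (2 * Suc j) =
        (U * W) * ((U * W) ^ j - const3 (\<alpha> ^ j) * Y1 ^ (2 * j)) +
        (const3 (\<alpha> ^ j) * Y1 ^ (2 * j)) * F"
      unfolding F by (simp add: const3_mult algebra_simps power2_eq_square)
    also have "\<dots> \<in> hom_ideal F G (2 * Suc j)"
      by (intro hom_ideal_add hom_ideal_mult[OF Suc, where e = 2]
          hom_ideal_mult[OF hom_ideal_left[OF hF], where e = "2 * j"]
          homogeneous_mult[OF hom] homogeneous_const3_mult homY) simp_all
    finally show ?case .
  qed simp
  obtain cf where cf_add: "\<And>H H' i j. cf (H + H') i j = cf H i j + cf H' i j"
    and cf_mult: "\<And>c H i j. cf (const3 c * H) i j = c * cf H i j"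
    and cf: "\<And>H. homogeneous d H \<Longrightarrow> H = (\<Sum>(i, j) \<in> {(i, j). i + j \<le> d}.
           const3 (cf H i j) * (Y1 ^ i * U ^ j * W ^ (d - i - j)))"
    by (rule vertex_frame_expansion[OF frame, where d = d]) (rule that; iprover)
  define T where "T = {(i, j). i + j \<le> d}"
  \<comment> \<open>The exponents whose reduced monomial is not divisible by
    \<open>Y1 ^ 4\<close>.\<close>
  define T' where "T' = {p \<in> T. fst p + 2 * snd p < 4}"
  have fin: "finite T" unfolding T_def by (rule finite_exponents)
  define \<psi> where "\<psi> = (\<lambda>m H. \<Sum>(i, j) \<in> {p \<in> T'. fst p + 2 * snd p = m}. cf H i j * \<alpha> ^ j)"
  \<comment> \<open>\<open>W ^ d\<close> times the monomial with exponents (i, j) reduces to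
    \<open>\<alpha> ^ j\<close> times \<open>N (i, j)\<close>; i + j <= d keeps the exponent of
    \<open>W\<close> from being truncated.\<close>
  define N where "N = (\<lambda>(i, j). Y1 ^ (i + 2 * j) * W ^ (2 * d - (i + 2 * j)))"
  show "\<exists>\<psi> :: nat \<Rightarrow> tpoly \<Rightarrow> complex.
      (\<forall>j H H'. \<psi> j (H + H') = \<psi> j H + \<psi> j H') \<and> (\<forall>j c H. \<psi> j (const3 c * H) = c * \<psi> j H) \<and>
      (\<forall>H. homogeneous d H \<longrightarrow> (\<forall>j<4. \<psi> j H = 0) \<longrightarrow>
        (\<exists>e T. homogeneous e T \<and> eval3 T 0 p2 p3 \<noteq> 0 \<and> T * H \<in> hom_ideal F G (d + e)))"
  proof (intro exI[of _ \<psi>] conjI allI impI)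
    show "\<psi> j (H + H') = \<psi> j H + \<psi> j H'" for j H H'
      by (simp add: \<psi>_def cf_add algebra_simps sum.distrib case_prod_beta)
    show "\<psi> j (const3 c * H) = c * \<psi> j H" for j c H
      by (simp add: \<psi>_def cf_mult sum_distrib_left case_prod_beta mult.assoc)
  next
    fix H assume H: "homogeneous d H" and \<psi>0: "\<forall>j<4. \<psi> j H = 0"
    have low: "(\<Sum>(i, j) \<in> T'. const3 (cf H i j * \<alpha> ^ j) * N (i, j)) = 0"
    proof -
      \<comment> \<open>\<open>N (i, j)\<close> depends only on m = i + 2 j, so collecting equal m
        produces \<open>\<psi> m H\<close>.\<close>
      have "(\<Sum>(i, j) \<in> T'. const3 (cf H i j * \<alpha> ^ j) * N (i, j)) =
        (\<Sum>m<4. \<Sum>(i, j) \<in> {p \<in> T'. fst p + 2 * snd p = m}. const3 (cf H i j * \<alpha> ^ j) * N (i, j))"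
        using fin by (intro sum.group[symmetric]) (auto simp: T'_def)
      also have "\<dots> = (\<Sum>m<4. const3 (\<psi> m H) * (Y1 ^ m * W ^ (2 * d - m)))"
      proof (rule sum.cong[OF refl])
        fix m
        have const3_sum: "const3 (\<Sum>p\<in>I. c p) = (\<Sum>p\<in>I. const3 (c p))" for I :: "(nat \<times> nat) set" and c
          by (induction I rule: infinite_finite_induct) (simp_all add: const3_add)
        show "(\<Sum>(i, j) \<in> {p \<in> T'. fst p + 2 * snd p = m}. const3 (cf H i j * \<alpha> ^ j) * N (i, j)) =
            const3 (\<psi> m H) * (Y1 ^ m * W ^ (2 * d - m))"
          unfolding \<psi>_def const3_sum sum_distrib_right case_prod_beta
          by (intro sum.cong) (auto simp: N_def)
      qed
      also have "\<dots> = 0" using \<psi>0 by simp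
      finally show ?thesis .
    qed
    have N: "N (i, j) \<in> hom_ideal F G (2 * d)" if "(i, j) \<in> T - T'" for i j
    proof -
      have *: "i + j \<le> d" "4 \<le> i + 2 * j" using that by (auto simp: T_def T'_def)
      then have "N (i, j) = (Y1 ^ (i + 2 * j - 4) * W ^ (2 * d - (i + 2 * j))) * Y1 ^ 4"
        unfolding N_def by (simp add: mult_ac flip: power_add)
      also have "\<dots> \<in> hom_ideal F G (2 * d)"
        using * by (intro hom_ideal_mult[OF Y4, where e = "2 * d - 4"] homYW) auto
      finally show ?thesis .
    qed
    have mono: "W ^ d * (Y1 ^ i * U ^ j * W ^ (d - i - j)) - const3 (\<alpha> ^ j) * N (i, j)
        \<in> hom_ideal F G (2 * d)" if "(i, j) \<in> T" for i j
    proof -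
      have *: "i + j \<le> d" using that by (auto simp: T_def)
      have W: "W ^ d * W ^ (d - i - j) = W ^ (2 * d - (i + 2 * j)) * W ^ j"
      proof -
        have "d + (d - i - j) = 2 * d - (i + 2 * j) + j" using * by arith
        then show ?thesis unfolding power_add[symmetric] by (rule arg_cong)
      qed
      have "W ^ d * (Y1 ^ i * U ^ j * W ^ (d - i - j)) = Y1 ^ i * U ^ j * (W ^ d * W ^ (d - i - j))"
        by (simp only: mult_ac)
      also have "\<dots> = (Y1 ^ i * W ^ (2 * d - (i + 2 * j))) * (U * W) ^ j"
        unfolding W power_mult_distrib by (simp only: mult_ac)
      finally have "W ^ d * (Y1 ^ i * U ^ j * W ^ (d - i - j)) - const3 (\<alpha> ^ j) * N (i, j) =
          (Y1 ^ i * W ^ (2 * d - (i + 2 * j))) * ((U * W) ^ j - const3 (\<alpha> ^ j) * Y1 ^ (2 * j))"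
        unfolding N_def by (simp add: algebra_simps power_add)
      also have "\<dots> \<in> hom_ideal F G (2 * d)"
        using * by (intro hom_ideal_mult[OF pow, where e = "2 * d - 2 * j"] homYW) auto
      finally show ?thesis .
    qed
    have "W ^ d * H = (\<Sum>(i, j) \<in> T. const3 (cf H i j) * (W ^ d * (Y1 ^ i * U ^ j * W ^ (d - i - j))))"
      by (subst (1) cf[OF H]) (simp add: sum_distrib_left case_prod_beta mult_ac T_def)
    also have "\<dots> = (\<Sum>(i, j) \<in> T. const3 (cf H i j) *
          (W ^ d * (Y1 ^ i * U ^ j * W ^ (d - i - j)) - const3 (\<alpha> ^ j) * N (i, j))) +
        (\<Sum>(i, j) \<in> T. const3 (cf H i j * \<alpha> ^ j) * N (i, j))"
      unfolding sum.distrib[symmetric]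
      by (intro sum.cong refl) (auto simp: algebra_simps const3_mult)
    also have "(\<Sum>(i, j) \<in> T. const3 (cf H i j * \<alpha> ^ j) * N (i, j)) =
        (\<Sum>(i, j) \<in> T - T'. const3 (cf H i j * \<alpha> ^ j) * N (i, j))"
    proof -
      have "T' \<subseteq> T" unfolding T'_def by blast
      note sum.subset_diff[OF this fin]
      from this[of "\<lambda>(i, j). const3 (cf H i j * \<alpha> ^ j) * N (i, j)"] show ?thesis
        unfolding low add_0_right .
    qed
    also have "(\<Sum>(i, j) \<in> T. const3 (cf H i j) *
          (W ^ d * (Y1 ^ i * U ^ j * W ^ (d - i - j)) - const3 (\<alpha> ^ j) * N (i, j))) +
        (\<Sum>(i, j) \<in> T - T'. const3 (cf H i j * \<alpha> ^ j) * N (i, j)) \<in> hom_ideal F G (2 * d)"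
      using N mono by (intro hom_ideal_add hom_ideal_sum) (auto intro!: hom_ideal_const3_mult)
    finally have "W ^ d * H \<in> hom_ideal F G (d + d)" by (simp add: mult_2)
    moreover have "homogeneous d (W ^ d)" by (rule homW) simp
    moreover have "eval3 (W ^ d) 0 p2 p3 \<noteq> 0" using vertex_frameD(4)[OF frame] by simp
    ultimately show "\<exists>e T. homogeneous e T \<and> eval3 T 0 p2 p3 \<noteq> 0 \<and> T * H \<in> hom_ideal F G (d + e)"
      by blast
  qed
qed

lemma intersection_number_pencil:
  assumes frame: "vertex_frame U W p2 p3"
    and F: "F = U * W - const3 \<alpha> * Y1 ^ 2"
    and G: "G = (U * W + const3 q * Y1 ^ 2) ^ 2 - const3 f * Y1 ^ 4"
    and k: "(\<alpha> + q) ^ 2 \<noteq> f"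
  shows "intersection_number F G 0 p2 p3 = 4"
proof -
  obtain \<phi> t where \<phi>: "\<And>H H'. \<phi> (H + H') = \<phi> H + \<phi> H'" "\<And>H H'. \<phi> (H * H') = \<phi> H * \<phi> H'"
    "\<And>c. \<phi> (const3 c) = [:c:]" "\<And>H. poly (\<phi> H) 0 = eval3 H 0 p2 p3"
    and Y1: "\<phi> Y1 = [:0, 1:]" and W: "\<phi> W = [:t:]" "t \<noteq> 0" and U: "\<phi> U = [:0, 0, \<alpha> / t:]"
    by (rule vertex_frame_substitution[OF frame, where \<alpha> = \<alpha>]) (rule that; iprover)
  have \<phi>_diff: "\<phi> (H - H') = \<phi> H - \<phi> H'" for H H'
    using \<phi>(1)[of "H - H'" H'] by simp
  have \<phi>_power: "\<phi> (H ^ n) = \<phi> H ^ n" for H n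
    using \<phi>(3)[of 1] by (induction n) (simp_all add: \<phi> pCons_one)
  have \<phi>F: "\<phi> F = 0"
    unfolding F \<phi>_diff \<phi>_power \<phi>(2,3) U W(1) Y1 using W(2) by (simp add: power2_eq_square)
  \<comment> \<open>On the branch, \<open>U * W\<close> takes the value \<alpha> times the squared
    parameter.\<close>
  have \<phi>G: "\<phi> G = [:0, 1:] ^ 4 * [:(\<alpha> + q) ^ 2 - f:]"
    unfolding G \<phi>_diff \<phi>_power \<phi>(1-3) U W(1) Y1 using W(2)
    by (simp add: power2_eq_square power4_eq_xxxx algebra_simps)
  have "enat 4 \<le> intersection_number F G 0 p2 p3"
    by (rule intersection_number_ge[OF \<phi> Y1 W vertex_frameD(2)[OF frame] \<phi>F])
      (simp only: \<phi>G dvd_triv_left)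
  with intersection_number_pencil_le[OF assms] show ?thesis
    by (simp add: numeral_eq_enat order_antisym)
qed

text \<open>The adjugate of a \<open>3 \<times> 3\<close> matrix with \<open>b3 = 0\<close>.\<close>

lemma cramer3:
  fixes u v w :: "'a::comm_ring_1"
  assumes "r1 = a1 * u + b1 * v + c1 * w" "r2 = a2 * u + b2 * v + c2 * w" "r3 = a3 * u + c3 * w"
    and "D = a1 * b2 * c3 - b1 * (a2 * c3 - c2 * a3) - c1 * b2 * a3"
  shows "D * u = (b2 * c3) * r1 - (b1 * c3) * r2 + (b1 * c2 - c1 * b2) * r3"
    and "D * v = (c2 * a3 - a2 * c3) * r1 + (a1 * c3 - c1 * a3) * r2 + (c1 * a2 - a1 * c2) * r3"
    and "D * w = (b1 * a3) * r2 - (b2 * a3) * r1 + (a1 * b2 - b1 * a2) * r3"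
  unfolding assms by (simp_all add: algebra_simps)

text \<open>If the conic is not tangent to the line \<open>U = 0\<close> at the point, then the squares of the local
  coordinates lie in the ideal, by Nakayama's lemma: \<open>Y1 F\<close>, \<open>U F\<close> and \<open>G\<close> are combinations of
  \<open>Y1^2\<close>, \<open>Y1 U\<close>, \<open>U^2\<close> whose coefficient matrix is invertible at the point.\<close>

lemma intersection_number_transversal_le:
  assumes frame: "vertex_frame U W p2 p3"
    and F: "F = const3 A * Y1 ^ 2 + const3 B * (Y1 * U) + const3 C * (Y1 * W) + const3 D * U ^ 2
              + const3 E * (U * W)"
    and G: "G = (U * W + const3 q * Y1 ^ 2) ^ 2 - const3 f * Y1 ^ 4"
    and C: "C \<noteq> 0"
  shows "intersection_number F G 0 p2 p3 \<le> enat 3"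
proof (rule intersection_number_le)
  fix d
  note hom = vertex_frameD(1,2)[OF frame]
  note homU = homogeneous_power[OF hom(1)] and homW = homogeneous_power[OF hom(2)]
    and homY = homogeneous_power[OF homogeneous_basic(4)]
  have homY1: "homogeneous 1 Y1" by simp
  have hF: "homogeneous 2 F" unfolding F
    by (intro homogeneous_add homogeneous_const3_mult homogeneous_mult[OF hom]
        homogeneous_mult[OF homY1 hom(1)] homogeneous_mult[OF homY1 hom(2)] homY homU) simp_all
  have hG: "homogeneous 4 G" unfolding G
    by (intro homogeneous_diff homogeneous_add homogeneous_const3_mult homogeneous_mult[OF hom] homY
        homogeneous_power[where d = 2]) simp_all
  \<comment> \<open>Rows of the matrix: \<open>Y1 * F\<close>, \<open>U * F\<close>,
    \<open>G\<close>; columns: \<open>Y1 ^ 2\<close>, \<open>Y1 * U\<close>, \<open>U ^ 2\<close>.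
    Every term of \<open>G\<close> is divisible by \<open>Y1 ^ 2\<close> or \<open>U ^ 2\<close>,
    whence the zero entry in its row.\<close>
  define a1 where "a1 = const3 A * Y1 + const3 C * W"
  define b1 where "b1 = const3 B * Y1 + const3 E * W"
  define c1 where "c1 = const3 D * Y1"
  define a2 where "a2 = const3 A * U"
  define b2 where "b2 = const3 B * U + const3 C * W"
  define c2 where "c2 = const3 D * U + const3 E * W"
  define a3 where "a3 = const3 (q + q) * (U * W) + const3 (q ^ 2 - f) * Y1 ^ 2"
  define c3 where "c3 = W ^ 2"
  note defs = a1_def b1_def c1_def a2_def b2_def c2_def a3_def c3_def
  define \<Delta> where "\<Delta> = a1 * b2 * c3 - b1 * (a2 * c3 - c2 * a3) - c1 * b2 * a3"
  have r: "Y1 * F = a1 * Y1 ^ 2 + b1 * (Y1 * U) + c1 * U ^ 2"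
    "U * F = a2 * Y1 ^ 2 + b2 * (Y1 * U) + c2 * U ^ 2"
    "G = a3 * Y1 ^ 2 + c3 * U ^ 2"
    unfolding defs F G const3_add const3_diff const3_power
    by (simp_all add: algebra_simps power2_eq_square power4_eq_xxxx)
  have h1: "homogeneous 1 a1" "homogeneous 1 b1" "homogeneous 1 c1" "homogeneous 1 a2"
    "homogeneous 1 b2" "homogeneous 1 c2"
    unfolding defs by (intro homogeneous_add homogeneous_const3_mult homY1 hom)+
  have h2: "homogeneous 2 a3" "homogeneous 2 c3"
    unfolding defs
    by (intro homogeneous_add homogeneous_const3_mult homogeneous_mult[OF hom] homY homW; simp)+
  have h11: "homogeneous 2 (M * M')" if "homogeneous 1 M" "homogeneous 1 M'" for M M'
    by (rule homogeneous_mult[OF that]) simp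
  have h12: "homogeneous 3 (M * M')" if "homogeneous 1 M" "homogeneous 2 M'" for M M'
    by (rule homogeneous_mult[OF that]) simp
  have h\<Delta>: "homogeneous 4 \<Delta>"
    unfolding \<Delta>_def
    by (intro homogeneous_diff homogeneous_mult[where d = 2 and e = 2] homogeneous_mult[where d = 1 and e = 3]
        h11 h12 h1 h2) simp_all
  \<comment> \<open>At the vertex \<open>Y1\<close> and \<open>U\<close> vanish, and the determinant
    reduces to \<open>C ^ 2 * W ^ 4\<close>.\<close>
  have e\<Delta>: "eval3 \<Delta> 0 p2 p3 \<noteq> 0"
    unfolding \<Delta>_def defs using C vertex_frameD(3,4)[OF frame] by simp
  have I: "M * (Y1 * F) \<in> hom_ideal F G 6" "M * (U * F) \<in> hom_ideal F G 6" if "homogeneous 3 M" for M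
    by (rule hom_ideal_mult[OF hom_ideal_mult[OF hom_ideal_left[OF hF], where e = 1 and n = 3] that];
        use hom in simp)+
  have IG: "M * G \<in> hom_ideal F G 6" if "homogeneous 2 M" for M
    by (rule hom_ideal_mult[OF hom_ideal_right[OF hG] that]) simp
  note cramer = cramer3[OF r \<Delta>_def]
  have \<Delta>: "\<Delta> * Y1 ^ 2 \<in> hom_ideal F G 6" "\<Delta> * (Y1 * U) \<in> hom_ideal F G 6"
    "\<Delta> * U ^ 2 \<in> hom_ideal F G 6"
    unfolding cramer
    by (intro hom_ideal_add hom_ideal_diff I IG homogeneous_diff h11 h12 h1 h2)+
  have mono: "\<Delta> * (Y1 ^ i * U ^ j * W ^ (d - i - j)) \<in> hom_ideal F G (d + 4)"
    if ij: "i + j \<le> d" "2 \<le> i + j" for i j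
  proof -
    have homM: "homogeneous n (Y1 ^ a * U ^ b * W ^ c)" if "n = a + b + c" for n a b c
      using that by (intro homogeneous_mult[of "a + b" _ c] homogeneous_mult[of a _ b] homY homU homW) simp_all
    consider "2 \<le> i" | "i = 1" "1 \<le> j" | "i = 0" "2 \<le> j" using ij by linarith
    then show ?thesis
    proof cases
      case 1
      then obtain m where m: "i = m + 2" by (metis add.commute le_Suc_ex)
      have "\<Delta> * (Y1 ^ i * U ^ j * W ^ (d - i - j)) = (Y1 ^ m * U ^ j * W ^ (d - i - j)) * (\<Delta> * Y1 ^ 2)"
        unfolding m power_add by (simp only: mult_ac)
      also have "\<dots> \<in> hom_ideal F G (d + 4)"
        using ij m by (intro hom_ideal_mult[OF \<Delta>(1) homM[OF refl]]) simp
      finally show ?thesis .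
    next
      case 2
      then obtain m where m: "j = m + 1" by (metis add.commute le_Suc_ex)
      have "\<Delta> * (Y1 ^ i * U ^ j * W ^ (d - i - j)) = (Y1 ^ 0 * U ^ m * W ^ (d - i - j)) * (\<Delta> * (Y1 * U))"
        unfolding m power_add \<open>i = 1\<close> power_one_right power_0 by (simp only: mult_ac mult_1_left)
      also have "\<dots> \<in> hom_ideal F G (d + 4)"
        using ij m 2 by (intro hom_ideal_mult[OF \<Delta>(2) homM[OF refl]]) simp
      finally show ?thesis .
    next
      case 3
      then obtain m where m: "j = m + 2" by (metis add.commute le_Suc_ex)
      have "\<Delta> * (Y1 ^ i * U ^ j * W ^ (d - i - j)) = (Y1 ^ i * U ^ m * W ^ (d - i - j)) * (\<Delta> * U ^ 2)"
        unfolding m power_add by (simp only: mult_ac)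
      also have "\<dots> \<in> hom_ideal F G (d + 4)"
        using ij m 3 by (intro hom_ideal_mult[OF \<Delta>(3) homM[OF refl]]) simp
      finally show ?thesis .
    qed
  qed
  obtain cf where cf_add: "\<And>H H' i j. cf (H + H') i j = cf H i j + cf H' i j"
    and cf_mult: "\<And>c H i j. cf (const3 c * H) i j = c * cf H i j"
    and cf: "\<And>H. homogeneous d H \<Longrightarrow> H = (\<Sum>(i, j) \<in> {(i, j). i + j \<le> d}.
           const3 (cf H i j) * (Y1 ^ i * U ^ j * W ^ (d - i - j)))"
    by (rule vertex_frame_expansion[OF frame, where d = d]) (rule that; iprover)
  \<comment> \<open>The constant and the two linear coefficients in the local coordinates; only the
    indices 0, 1, 2 are consulted.\<close>
  define \<psi> :: "nat \<Rightarrow> tpoly \<Rightarrow> complex" where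
    "\<psi> = (\<lambda>m H. if m = 0 then cf H 0 0 else if m = 1 then cf H 1 0 else cf H 0 1)"
  show "\<exists>\<psi> :: nat \<Rightarrow> tpoly \<Rightarrow> complex.
      (\<forall>j H H'. \<psi> j (H + H') = \<psi> j H + \<psi> j H') \<and> (\<forall>j c H. \<psi> j (const3 c * H) = c * \<psi> j H) \<and>
      (\<forall>H. homogeneous d H \<longrightarrow> (\<forall>j<3. \<psi> j H = 0) \<longrightarrow>
        (\<exists>e T. homogeneous e T \<and> eval3 T 0 p2 p3 \<noteq> 0 \<and> T * H \<in> hom_ideal F G (d + e)))"
  proof (intro exI[of _ \<psi>] conjI allI impI)
    show "\<psi> j (H + H') = \<psi> j H + \<psi> j H'" for j H H'
      by (simp add: \<psi>_def cf_add)
    show "\<psi> j (const3 c * H) = c * \<psi> j H" for j c H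
      by (simp add: \<psi>_def cf_mult)
  next
    fix H assume H: "homogeneous d H" and \<psi>0: "\<forall>j<3. \<psi> j H = 0"
    have low: "cf H i j = 0" if "i + j < 2" for i j
    proof -
      have "\<psi> 0 H = 0" "\<psi> 1 H = 0" "\<psi> 2 H = 0" using \<psi>0 by simp_all
      moreover have "i = 0 \<and> j = 0 \<or> i = 1 \<and> j = 0 \<or> i = 0 \<and> j = 1" using that by linarith
      ultimately show ?thesis by (auto simp: \<psi>_def)
    qed
    have "\<Delta> * H = (\<Sum>(i, j) \<in> {(i, j). i + j \<le> d}.
        const3 (cf H i j) * (\<Delta> * (Y1 ^ i * U ^ j * W ^ (d - i - j))))"
      by (subst (1) cf[OF H]) (simp add: sum_distrib_left case_prod_beta mult_ac)
    also have "\<dots> \<in> hom_ideal F G (d + 4)"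
    proof (rule hom_ideal_sum, clarify)
      fix i j assume "i + j \<le> d"
      then show "const3 (cf H i j) * (\<Delta> * (Y1 ^ i * U ^ j * W ^ (d - i - j))) \<in> hom_ideal F G (d + 4)"
        using low[of i j] mono[of i j]
        by (cases "i + j < 2") (auto intro: hom_ideal_const3_mult)
    qed
    finally show "\<exists>e T. homogeneous e T \<and> eval3 T 0 p2 p3 \<noteq> 0 \<and> T * H \<in> hom_ideal F G (d + e)"
      using h\<Delta> e\<Delta> by blast
  qed
qed

text \<open>Off the conic \<open>F\<close> is a unit of the local ring: \<open>T\<close> =
  \<open>F\<close> puts every \<open>H\<close> into the ideal without any condition.\<close>

lemma intersection_number_eq_0:
  assumes "homogeneous m F" "eval3 F p1 p2 p3 \<noteq> 0"
  shows "intersection_number F G p1 p2 p3 = 0"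
proof -
  have "intersection_number F G p1 p2 p3 \<le> enat 0"
  proof (rule intersection_number_le, intro exI[of _ "\<lambda>_ _. 0"] conjI allI impI)
    fix d H assume "homogeneous d H"
    then have "F * H \<in> hom_ideal F G (d + m)"
      by (subst mult.commute) (rule hom_ideal_mult[OF hom_ideal_left[OF assms(1)]]; simp)
    with assms show "\<exists>e T. homogeneous e T \<and> eval3 T p1 p2 p3 \<noteq> 0 \<and> T * H \<in> hom_ideal F G (d + e)"
      by blast
  qed simp_all
  then show ?thesis by (simp flip: zero_enat_def)
qed

text \<open>\<open>K\<close> decides whether the conic passes through the vertex, \<open>C\<close>
  whether it is tangent to \<open>U\<close> = 0 there. Nonzero values would bound the number by 0
  and 3 respectively.\<close>

lemma tangent_of_intersection_number:
  assumes frame: "vertex_frame U W p2 p3"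
    and F: "F = const3 A * Y1 ^ 2 + const3 B * (Y1 * U) + const3 C * (Y1 * W) + const3 D * U ^ 2
              + const3 E * (U * W) + const3 K * W ^ 2"
    and hF: "homogeneous 2 F"
    and G: "G = (U * W + const3 q * Y1 ^ 2) ^ 2 - const3 f * Y1 ^ 4"
    and num: "intersection_number F G 0 p2 p3 = 4"
  shows "C = 0" "K = 0"
proof -
  note e = vertex_frameD(3,4)[OF frame]
  show K: "K = 0"
  proof (rule ccontr)
    assume "K \<noteq> 0"
    then have "eval3 F 0 p2 p3 \<noteq> 0" unfolding F using e by simp
    from intersection_number_eq_0[OF hF this] num show False by simp
  qed
  show "C = 0"
  proof (rule ccontr)
    assume "C \<noteq> 0"
    with intersection_number_transversal_le[OF frame _ G, of F A B C D E] K num show False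
      unfolding F by (simp add: numeral_eq_enat)
  qed
qed

section \<open>Conics contained in the quartic\<close>

text \<open>Vieta's relations for the roots r, s of D X^2 + B X + A.\<close>

lemma split_quadratic:
  fixes A B D :: complex
  assumes "D \<noteq> 0"
  obtains r s where "A = D * r * s" "B = - D * (r + s)"
proof -
  define w where "w = csqrt (B ^ 2 - 4 * A * D)"
  have w: "w ^ 2 = B ^ 2 - 4 * A * D" by (simp add: w_def)
  show thesis
  proof (rule that)
    have "(- B + w) * (- B - w) = 4 * A * D" using w by (simp add: algebra_simps power2_eq_square)
    moreover have "D * ((- B + w) / (2 * D)) * ((- B - w) / (2 * D)) = ((- B + w) * (- B - w)) / (4 * D)"
      using assms by (simp add: field_simps)
    ultimately show "A = D * ((- B + w) / (2 * D)) * ((- B - w) / (2 * D))"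
      using assms by simp
    show "B = - D * ((- B + w) / (2 * D) + (- B - w) / (2 * D))"
      using assms by (simp add: field_simps)
  qed
qed

text \<open>The conic \<open>y3 = -(A + B y2 + D y2^2) / C\<close> (in the chart \<open>y1 = 1\<close>) is rational with
  parameter \<open>y2\<close>, and \<open>y2 y3\<close> is not constant on it.\<close>

lemma conic_double_contact_absurd:
  fixes A B C D \<beta> \<gamma> :: complex
  assumes sub: "\<And>y1 y2 y3. (y1, y2, y3) \<noteq> (0, 0, 0) \<Longrightarrow>
      A * y1 ^ 2 + B * y1 * y2 + C * y1 * y3 + D * y2 ^ 2 = 0 \<Longrightarrow>
      (y2 * y3 - \<beta> * y1 ^ 2) * (y2 * y3 - \<gamma> * y1 ^ 2) = 0"
    and nofac: "\<And>l1 l2 l3 m1 m2 m3. A = l1 * m1 \<Longrightarrow> B = l1 * m2 + l2 * m1 \<Longrightarrow>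
      C = l1 * m3 + l3 * m1 \<Longrightarrow> D = l2 * m2 \<Longrightarrow> 0 = l2 * m3 + l3 * m2 \<Longrightarrow> 0 = l3 * m3 \<Longrightarrow> False"
  shows "D = 0"
proof (rule ccontr)
  assume D: "D \<noteq> 0"
  have C: "C \<noteq> 0"
  proof
    assume "C = 0"
    obtain r s where "A = D * r * s" "B = - D * (r + s)" using split_quadratic[OF D] .
    \<comment> \<open>Without the \<open>C\<close> term the form is D (y2 - r y1) (y2 - s
      y1).\<close>
    then show False
      using nofac[of "- D * r" "- s" 1 D 0 0] \<open>C = 0\<close> by (simp add: algebra_simps)
  qed
  \<comment> \<open>Up to sign, the cubics are \<open>C\<close> (y2 y3 - \<beta>) and
    \<open>C\<close> (y2 y3 - \<gamma>) on the parametrised conic; their leading coefficient is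
    \<open>D\<close>.\<close>
  have "poly ([:C * \<beta>, A, B, D:] * [:C * \<gamma>, A, B, D:]) t = 0" for t
  proof -
    define y where "y = - (A + B * t + D * t ^ 2) / C"
    have Cy: "C * y = - (A + B * t + D * t ^ 2)" using C by (simp add: y_def)
    have "(t * y - \<beta> * 1 ^ 2) * (t * y - \<gamma> * 1 ^ 2) = 0"
      by (rule sub) (simp_all add: Cy)
    moreover have "(t * (C * y) - C * \<beta>) * (t * (C * y) - C * \<gamma>) =
        C ^ 2 * ((t * y - \<beta> * 1 ^ 2) * (t * y - \<gamma> * 1 ^ 2))"
      by (simp add: algebra_simps power2_eq_square)
    ultimately have "(t * (C * y) - C * \<beta>) * (t * (C * y) - C * \<gamma>) = 0" by simp
    then show ?thesis unfolding Cy by (simp add: algebra_simps power2_eq_square)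
  qed
  then have "[:C * \<beta>, A, B, D:] * [:C * \<gamma>, A, B, D:] = 0" using poly_all_0_iff_0 by blast
  with D show False by simp
qed

text \<open>On y1 = 0 the conic can contain only the two vertices. This confines a conic with
  \<open>D\<close> or \<open>K\<close> nonzero to the shape excluded by
  \<open>conic_double_contact_absurd\<close>, up to exchanging y2 and y3; the remaining shape is a
  hyperbola, parametrised below.\<close>

lemma conic_in_pencil:
  fixes A B C D E K \<beta> \<gamma> :: complex
  assumes sub: "\<And>y1 y2 y3. (y1, y2, y3) \<noteq> (0, 0, 0) \<Longrightarrow>
      A * y1 ^ 2 + B * y1 * y2 + C * y1 * y3 + D * y2 ^ 2 + E * y2 * y3 + K * y3 ^ 2 = 0 \<Longrightarrow>
      (y2 * y3 - \<beta> * y1 ^ 2) * (y2 * y3 - \<gamma> * y1 ^ 2) = 0"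
    and nofac: "\<And>l1 l2 l3 m1 m2 m3. A = l1 * m1 \<Longrightarrow> B = l1 * m2 + l2 * m1 \<Longrightarrow>
      C = l1 * m3 + l3 * m1 \<Longrightarrow> D = l2 * m2 \<Longrightarrow> E = l2 * m3 + l3 * m2 \<Longrightarrow> K = l3 * m3 \<Longrightarrow> False"
  shows "B = 0 \<and> C = 0 \<and> D = 0 \<and> K = 0"
proof -
  have infinity: "y2 * y3 = 0" if "D * y2 ^ 2 + E * y2 * y3 + K * y3 ^ 2 = 0" for y2 y3
    using sub[of 0 y2 y3] that by auto
  have EK: "E = 0 \<and> K = 0" if "D \<noteq> 0"
  proof -
    obtain r s where rs: "K = D * r * s" "E = - D * (r + s)" using split_quadratic[OF \<open>D \<noteq> 0\<close>] .
    \<comment> \<open>(r : 1) and (s : 1) are the points of the conic on the line y1 = 0.\<close>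
    have "r * 1 = 0" "s * 1 = 0"
      by (rule infinity; simp add: rs algebra_simps power2_eq_square)+
    then show ?thesis using rs by simp
  qed
  have D: "D = 0"
  proof (rule ccontr)
    assume "D \<noteq> 0"
    then have "E = 0" "K = 0" using EK by auto
    have "D = 0"
    proof (rule conic_double_contact_absurd[of A B C D \<beta> \<gamma>])
      fix y1 y2 y3 :: complex assume "(y1, y2, y3) \<noteq> (0, 0, 0)"
        "A * y1 ^ 2 + B * y1 * y2 + C * y1 * y3 + D * y2 ^ 2 = 0"
      then show "(y2 * y3 - \<beta> * y1 ^ 2) * (y2 * y3 - \<gamma> * y1 ^ 2) = 0"
        using \<open>E = 0\<close> \<open>K = 0\<close> by (intro sub) simp_all
    next
      fix l1 l2 l3 m1 m2 m3
      assume "A = l1 * m1" "B = l1 * m2 + l2 * m1" "C = l1 * m3 + l3 * m1" "D = l2 * m2"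
        "0 = l2 * m3 + l3 * m2" "0 = l3 * m3"
      then show False using \<open>E = 0\<close> \<open>K = 0\<close> nofac[of l1 m1 m2 l2 m3 l3] by simp
    qed
    with \<open>D \<noteq> 0\<close> show False ..
  qed
  have K: "K = 0"
  proof (rule ccontr)
    assume "K \<noteq> 0"
    have "E * 1 = 0"
      using infinity[of 1 "- E / K"] \<open>K \<noteq> 0\<close> D by (simp add: field_simps power2_eq_square)
    then have "E = 0" by simp
    have "K = 0"
    proof (rule conic_double_contact_absurd[of A C B K \<beta> \<gamma>])
      fix y1 y2 y3 :: complex assume "(y1, y2, y3) \<noteq> (0, 0, 0)"
        "A * y1 ^ 2 + C * y1 * y2 + B * y1 * y3 + K * y2 ^ 2 = 0"
      then show "(y2 * y3 - \<beta> * y1 ^ 2) * (y2 * y3 - \<gamma> * y1 ^ 2) = 0"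
        using sub[of y1 y3 y2] D \<open>E = 0\<close> by (auto simp: mult.commute[of y3 y2] add.commute add.left_commute)
    next
      fix l1 l2 l3 m1 m2 m3
      assume ABC: "A = l1 * m1" "C = l1 * m2 + l2 * m1" "B = l1 * m3 + l3 * m1"
        and "K = l2 * m2" and 0: "0 = l2 * m3 + l3 * m2" "0 = l3 * m3"
      have "D = l3 * m3" using 0 D by simp
      moreover have "E = l3 * m2 + l2 * m3" unfolding \<open>E = 0\<close> 0(1) by (rule add.commute)
      ultimately show False using nofac[OF ABC(1,3,2)] \<open>K = l2 * m2\<close> by blast
    qed
    with \<open>K \<noteq> 0\<close> show False ..
  qed
  \<comment> \<open>Otherwise y1 divides the form.\<close>
  have E: "E \<noteq> 0" using nofac[of 1 A B 0 C 0] D K by auto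
  define \<kappa> where "\<kappa> = B * C - A * E"
  \<comment> \<open>If it vanishes, the conic splits as ((C / E) y1 + y2) (B y1 + E y3).\<close>
  have \<kappa>: "\<kappa> \<noteq> 0"
  proof
    assume "\<kappa> = 0"
    then have "A = C / E * B" using E by (simp add: \<kappa>_def field_simps)
    then show False using nofac[of "C / E" B 0 1 E 0] D K E by (simp add: field_simps)
  qed
  text \<open>In the chart \<open>y1 = 1\<close> the conic is \<open>(E y2 + C) (E y3 + B) = \<kappa>\<close>, parametrised by
    \<open>s = E y2 + C\<close>.\<close>
  define p where "p = (\<lambda>\<beta>. [:- C * \<kappa>, \<kappa> + B * C - \<beta> * E ^ 2, - B:])"
  \<comment> \<open>\<open>p \<beta>\<close> is E^2 s (y2 y3 - \<beta>) in terms of s. The extra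
    factor \<open>[:0, 1:]\<close> covers s = 0, which the parametrisation misses. If
    \<open>p \<beta>\<close> is zero, its outer coefficients force \<open>B\<close> and
    \<open>C\<close> to vanish.\<close>
  have "poly ([:0, 1:] * (p \<beta> * p \<gamma>)) s = 0" for s
  proof (cases "s = 0")
    case False
    define y2 where "y2 = (s - C) / E"
    define y3 where "y3 = (\<kappa> / s - B) / E"
    have y2: "E * y2 = s - C" and y3: "s * (E * y3) = \<kappa> - B * s"
      using E False by (simp_all add: y2_def y3_def field_simps)
    have p: "poly (p \<beta>) s = E ^ 2 * s * (y2 * y3 - \<beta> * 1 ^ 2)" for \<beta>
    proof -
      have "E ^ 2 * s * (y2 * y3 - \<beta> * 1 ^ 2) = (E * y2) * (s * (E * y3)) - \<beta> * E ^ 2 * s"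
        by (simp add: algebra_simps power2_eq_square)
      then show ?thesis unfolding y2 y3 p_def by (simp add: algebra_simps power2_eq_square)
    qed
    have "(E * s) * (A * 1 ^ 2 + B * 1 * y2 + C * 1 * y3 + D * y2 ^ 2 + E * y2 * y3 + K * y3 ^ 2) =
        s * (A * E) + (B * s) * (E * y2) + C * (s * (E * y3)) + (E * y2) * (s * (E * y3))"
      using D K by (simp add: algebra_simps)
    also have "\<dots> = 0" unfolding y2 y3 \<kappa>_def by (simp add: algebra_simps)
    finally have "(y2 * y3 - \<beta> * 1 ^ 2) * (y2 * y3 - \<gamma> * 1 ^ 2) = 0"
      using E False by (intro sub) simp_all
    then show ?thesis by (auto simp: p)
  qed simp
  then have "[:0, 1:] * (p \<beta> * p \<gamma>) = 0" using poly_all_0_iff_0 by blast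
  then have "p \<beta> = 0 \<or> p \<gamma> = 0" by simp
  then show ?thesis using \<kappa> D K by (auto simp: p_def)
qed

section \<open>Classification of conics of orbit type\<close>

definition conic_poly :: "complex \<Rightarrow> complex \<Rightarrow> complex \<Rightarrow> complex \<Rightarrow> complex \<Rightarrow> complex \<Rightarrow> tpoly" where
  "conic_poly A B C D E K = const3 A * Y1 ^ 2 + const3 B * (Y1 * Y2) + const3 C * (Y1 * Y3)
     + const3 D * Y2 ^ 2 + const3 E * (Y2 * Y3) + const3 K * Y3 ^ 2"

lemma eval3_conic_poly [simp]: "eval3 (conic_poly A B C D E K) y1 y2 y3 =
    A * y1 ^ 2 + B * y1 * y2 + C * y1 * y3 + D * y2 ^ 2 + E * y2 * y3 + K * y3 ^ 2"
  by (simp add: conic_poly_def)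

lemma homogeneous_2_conic_poly:
  assumes "homogeneous 2 F"
  obtains A B C D E K where "F = conic_poly A B C D E K"
proof -
  define c where "c = (\<lambda>i j. coeff (coeff (coeff F (2 - i - j)) j) i)"
  have exponents: "{(i, j). i + j \<le> (2 :: nat)} = {(2, 0), (1, 1), (1, 0), (0, 2), (0, 1), (0, 0)}"
    by (auto simp: numeral_2_eq_2 le_Suc_eq)
  have "F = (\<Sum>(i, j) \<in> {(i, j). i + j \<le> 2}. const3 (c i j) * Y1 ^ i * Y2 ^ j * Y3 ^ (2 - i - j))"
    unfolding c_def by (rule homogeneous_expansion[OF assms])
  also have "\<dots> = conic_poly (c 2 0) (c 1 1) (c 1 0) (c 0 2) (c 0 1) (c 0 0)"
    unfolding exponents by (simp add: conic_poly_def mult.assoc add.assoc)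
  finally show thesis by (rule that)
qed

lemma irreducible_conic_no_factor:
  assumes "irreducible (conic_poly A B C D E K)"
    and "A = l1 * m1" "B = l1 * m2 + l2 * m1" "C = l1 * m3 + l3 * m1"
      "D = l2 * m2" "E = l2 * m3 + l3 * m2" "K = l3 * m3"
  shows False
proof -
  define L where "L = (\<lambda>l1 l2 l3. const3 l1 * Y1 + const3 l2 * Y2 + const3 l3 * Y3)"
  have "conic_poly A B C D E K = L l1 l2 l3 * L m1 m2 m3"
    unfolding conic_poly_def L_def assms(2-) const3_add const3_mult
    by (simp add: algebra_simps power2_eq_square)
  moreover have "\<not> is_unit (L c1 c2 c3)" for c1 c2 c3
  proof
    assume "is_unit (L c1 c2 c3)"
    then obtain M where "1 = L c1 c2 c3 * M" by (elim dvdE)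
    then have "eval3 1 0 0 0 = eval3 (L c1 c2 c3 * M) 0 0 0" by simp
    then show False by (simp add: L_def)
  qed
  ultimately show False using assms(1) irreducibleD by blast
qed

lemma orbit_type_pencil:
  assumes "orbit_type a b Q l C"
  obtains \<alpha> where "\<alpha> \<noteq> 0" "C = plane_curve l (pencil_conic \<alpha>)"
proof -
  define q :: complex where "q = of_real (qform Q l 1)"
  define f :: complex where "f = of_real (fcubic a b l)"
  let ?G = "section_poly a b Q l"
  have G: "?G = (Y2 * Y3 + const3 q * Y1 ^ 2) ^ 2 - const3 f * Y1 ^ 4"
    by (simp add: section_poly_def q_def f_def)
  obtain F where F: "homogeneous 2 F" "irreducible F" "C = plane_curve l F"
    and cases: "C \<subseteq> quartic_surface a b Q \<or>
      intersection_number F ?G 0 0 1 = 4 \<and> intersection_number F ?G 0 1 0 = 4"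
    using assms unfolding orbit_type_def irreducible_conic_def by blast
  obtain A B C' D E K where FA: "F = conic_poly A B C' D E K"
    using homogeneous_2_conic_poly[OF F(1)] .
  note nofac = irreducible_conic_no_factor[OF F(2)[unfolded FA]]
  have 0: "B = 0 \<and> C' = 0 \<and> D = 0 \<and> K = 0"
    using cases
  proof
    assume "C \<subseteq> quartic_surface a b Q"
    \<comment> \<open>The quartic is a difference of two squares; \<open>f\<close> may be negative,
      hence the complex square root.\<close>
    have sub: "(y2 * y3 - (csqrt f - q) * y1 ^ 2) * (y2 * y3 - (- csqrt f - q) * y1 ^ 2) = 0"
      if nz: "(y1, y2, y3) \<noteq> (0, 0, 0)" and "A * y1 ^ 2 + B * y1 * y2 + C' * y1 * y3 + D * y2 ^ 2
        + E * y2 * y3 + K * y3 ^ 2 = 0" for y1 y2 y3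
    proof -
      have "pt (of_real l * y1) y1 y2 y3 \<in> C"
        using that unfolding F(3) pt_in_plane_curve_iff[OF F(1) nz] by (simp add: FA)
      then have "pt (of_real l * y1) y1 y2 y3 \<in> plane_curve l ?G"
        unfolding plane_curve_section_poly
        using \<open>C \<subseteq> quartic_surface a b Q\<close> plane_curve_subset_real_plane F(3) by blast
      then have "eval3 ?G y1 y2 y3 = 0"
        unfolding pt_in_plane_curve_iff[OF homogeneous_section_poly nz] .
      then have "(y2 * y3 + q * y1 ^ 2) ^ 2 - csqrt f ^ 2 * y1 ^ 4 = 0" by (simp add: G)
      then show ?thesis by (simp add: algebra_simps power2_eq_square power4_eq_xxxx)
    qed
    show ?thesis
    proof (rule conic_in_pencil)
      fix y1 y2 y3 :: complex assume "(y1, y2, y3) \<noteq> (0, 0, 0)"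
        "A * y1 ^ 2 + B * y1 * y2 + C' * y1 * y3 + D * y2 ^ 2 + E * y2 * y3 + K * y3 ^ 2 = 0"
      then show "(y2 * y3 - (csqrt f - q) * y1 ^ 2) * (y2 * y3 - (- csqrt f - q) * y1 ^ 2) = 0"
        by (rule sub)
    qed (rule nofac)
  next
    assume num: "intersection_number F ?G 0 0 1 = 4 \<and> intersection_number F ?G 0 1 0 = 4"
    have "C' = 0 \<and> K = 0"
      using tangent_of_intersection_number[of Y2 Y3 0 1 F A B C' D E K ?G q f] F(1) num
      by (simp add: vertex_frame_def FA conic_poly_def G)
    moreover have "B = 0 \<and> D = 0"
      \<comment> \<open>Exchanging \<open>Y2\<close> and \<open>Y3\<close> exchanges
        \<open>B\<close> with \<open>C'\<close> and \<open>D\<close> with \<open>K\<close>.\<close>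
      using tangent_of_intersection_number[of Y3 Y2 1 0 F A C' B K E D ?G q f] F(1) num
      by (simp add: vertex_frame_def FA conic_poly_def G algebra_simps)
    ultimately show ?thesis by blast
  qed
  \<comment> \<open>Only A y1^2 + E y2 y3 is left; if either coefficient vanished, it would be a
    product of linear forms.\<close>
  have E: "E \<noteq> 0" using nofac[of 1 A 0 0 0 0] 0 by auto
  have A: "A \<noteq> 0" using nofac[of 0 0 0 1 E 0] 0 by auto
  show thesis
  proof (rule that)
    show "- A / E \<noteq> 0" using A E by simp
    have "eval3 F y1 y2 y3 = 0 \<longleftrightarrow> eval3 (pencil_conic (- A / E)) y1 y2 y3 = 0" for y1 y2 y3
      using 0 E by (simp add: FA field_simps add_eq_0_iff)
    then show "C = plane_curve l (pencil_conic (- A / E))"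
      unfolding F(3) by (rule plane_curve_cong)
  qed
qed

lemma pencil_touching_orbit_type:
  fixes \<alpha> l :: real
  assumes "\<alpha> \<noteq> 0"
  defines "C \<equiv> plane_curve l (pencil_conic (of_real \<alpha>))"
  shows "real_touching_conic a b Q l C" "orbit_type a b Q l C"
proof -
  define q :: complex where "q = of_real (qform Q l 1)"
  define f :: complex where "f = of_real (fcubic a b l)"
  let ?F = "pencil_conic (of_real \<alpha>)" and ?G = "section_poly a b Q l"
  have G: "?G = (Y2 * Y3 + const3 q * Y1 ^ 2) ^ 2 - const3 f * Y1 ^ 4"
    by (simp add: section_poly_def q_def f_def)
  have irr: "irreducible_conic l ?F C"
    using assms irreducible_pencil_conic[of "of_real \<alpha>"] homogeneous_pencil_conic
    by (simp add: irreducible_conic_def C_def)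
  have real: "real_subset C" by (simp add: C_def real_subset_pencil_iff)
  have on: "eval3 ?G y1 y2 y3 = ((of_real \<alpha> + q) ^ 2 - f) * y1 ^ 4"
    if "y2 * y3 = of_real \<alpha> * y1 ^ 2" for y1 y2 y3
  proof -
    have "eval3 ?G y1 y2 y3 = (y2 * y3 + q * y1 ^ 2) ^ 2 - f * y1 ^ 4" by (simp add: G)
    also have "\<dots> = ((of_real \<alpha> + q) ^ 2 - f) * y1 ^ 4"
      unfolding that by (simp add: algebra_simps power2_eq_square power4_eq_xxxx)
    finally show ?thesis .
  qed
  have "C \<subseteq> quartic_surface a b Q \<or>
      (\<forall>y1 y2 y3. (y1, y2, y3) \<noteq> (0, 0, 0) \<longrightarrow>
         pt (of_real l * y1) y1 y2 y3 \<in> C \<inter> quartic_surface a b Q \<longrightarrow>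
         intersection_number ?F ?G y1 y2 y3 \<ge> 2) \<and>
      intersection_number ?F ?G 0 0 1 = 4 \<and> intersection_number ?F ?G 0 1 0 = 4"
  proof (cases "(of_real \<alpha> + q) ^ 2 = f")
    case True
    have "C \<subseteq> plane_curve l ?G"
    proof
      fix P assume "P \<in> C"
      then obtain y1 y2 y3 where "P = pt (of_real l * y1) y1 y2 y3" "(y1, y2, y3) \<noteq> (0, 0, 0)"
        and "y2 * y3 = of_real \<alpha> * y1 ^ 2"
        unfolding C_def plane_curve_def by auto
      moreover from this(3) have "eval3 ?G y1 y2 y3 = 0" using on True by simp
      ultimately show "P \<in> plane_curve l ?G" unfolding plane_curve_def by blast
    qed
    then show ?thesis unfolding plane_curve_section_poly by blast
  next
    case False
    \<comment> \<open>All representatives of the two vertices are covered, because the touching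
      condition quantifies over coordinates.\<close>
    have four: "intersection_number ?F ?G 0 p2 p3 = 4"
      if "p2 = 0 \<and> p3 \<noteq> 0 \<or> p2 \<noteq> 0 \<and> p3 = 0" for p2 p3
      using that
    proof
      assume "p2 = 0 \<and> p3 \<noteq> 0"
      then show ?thesis
        using intersection_number_pencil[of Y2 Y3 p2 p3 ?F "of_real \<alpha>" ?G q f] False
        by (simp add: vertex_frame_def G pencil_conic_def)
    next
      assume "p2 \<noteq> 0 \<and> p3 = 0"
      then show ?thesis
        using intersection_number_pencil[of Y3 Y2 p2 p3 ?F "of_real \<alpha>" ?G q f] False
        by (simp add: vertex_frame_def G pencil_conic_def mult.commute)
    qed
    have "intersection_number ?F ?G y1 y2 y3 \<ge> 2"
      if nz: "(y1, y2, y3) \<noteq> (0, 0, 0)"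
        and P: "pt (of_real l * y1) y1 y2 y3 \<in> C \<inter> quartic_surface a b Q" for y1 y2 y3
    proof -
      have "pt (of_real l * y1) y1 y2 y3 \<in> plane_curve l ?G"
        unfolding plane_curve_section_poly
        using P plane_curve_subset_real_plane C_def by blast
      then have "eval3 ?G y1 y2 y3 = 0"
        unfolding pt_in_plane_curve_iff[OF homogeneous_section_poly nz] .
      moreover have y23: "y2 * y3 = of_real \<alpha> * y1 ^ 2"
        using P pt_in_plane_curve_iff[OF homogeneous_pencil_conic nz] by (simp add: C_def)
      ultimately have "y1 = 0" using on False by simp
      with y23 nz have "y2 = 0 \<and> y3 \<noteq> 0 \<or> y2 \<noteq> 0 \<and> y3 = 0" by auto
      with four \<open>y1 = 0\<close> show ?thesis by simp
    qed
    with four show ?thesis by simp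
  qed
  with irr real show "real_touching_conic a b Q l C" "orbit_type a b Q l C"
    unfolding real_touching_conic_def orbit_type_def by blast+
qed

theorem proposition3p7:
  fixes a b lam0 lam :: real and Q :: rqform
  assumes "a > 0" and "b > 0"
    and "\<And>l. (qform Q l 1)^2 - fcubic a b l \<ge> 0"
    and "\<And>l. (qform Q l 1)^2 - fcubic a b l = 0 \<longleftrightarrow> l = lam0"
    and "order lam0 (discr_poly a b Q) = 2"
    and "\<And>l. fcubic a b l \<ge> 0 \<Longrightarrow> l \<noteq> lam0 \<Longrightarrow> qform Q l 1 > sqrt (fcubic a b l)"
  shows "bij_betw
    (\<lambda>\<alpha>::real. real_plane lam \<inter>
       {pt y0 y1 y2 y3 | y0 y1 y2 y3. (y0, y1, y2, y3) \<noteq> (0, 0, 0, 0) \<and>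
          y2 * y3 = of_real \<alpha> * y1^2})
    {\<alpha>. \<alpha> \<noteq> 0}
    {C. real_touching_conic a b Q lam C \<and> orbit_type a b Q lam C}"
  unfolding real_plane_Int_conic
proof (rule bij_betw_imageI)
  show "inj_on (\<lambda>\<alpha>::real. plane_curve lam (pencil_conic (of_real \<alpha>))) {\<alpha>. \<alpha> \<noteq> 0}"
    by (rule inj_onI) (metis of_real_eq_iff pencil_point_iff)
  show "(\<lambda>\<alpha>::real. plane_curve lam (pencil_conic (of_real \<alpha>))) ` {\<alpha>. \<alpha> \<noteq> 0} =
      {C. real_touching_conic a b Q lam C \<and> orbit_type a b Q lam C}"
  proof (intro equalityI subsetI)
    fix C assume "C \<in> {C. real_touching_conic a b Q lam C \<and> orbit_type a b Q lam C}"
    then have real: "real_subset C" and "orbit_type a b Q lam C"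
      by (auto simp: real_touching_conic_def)
    then obtain \<alpha> where \<alpha>: "\<alpha> \<noteq> 0" "C = plane_curve lam (pencil_conic \<alpha>)"
      by (elim orbit_type_pencil)
    then have "\<alpha> \<in> \<real>" using real by (simp add: real_subset_pencil_iff)
    then obtain r :: real where "\<alpha> = of_real r" by (elim Reals_cases)
    with \<alpha> show "C \<in> (\<lambda>\<alpha>::real. plane_curve lam (pencil_conic (of_real \<alpha>))) ` {\<alpha>. \<alpha> \<noteq> 0}"
      by auto
  qed (auto intro: pencil_touching_orbit_type)
qed

end
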